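(* For all $n\geq1$, \[ P_{n}^{(\mathrm{lpk},\mathrm{ides})}(s,t) =\frac{1}{n!}\sum_{k,m=0}^n f(n,k,m) (1-s)^{\frac{n-k}{2}}(1-t)^{n-m}P_{k}^{\mathrm{lpk}}(s)A_{m}(t), \] where $P_{n}^{(\mathrm{lpk},\mathrm{ides})}(s,t)=\sum_{\pi\in\mathfrak{S}_{n}}s^{\mathrm{lpk}(\pi)}t^{\mathrm{ides}(\pi)+1}$.
   Context: $\mathfrak{S}_n$ is the symmetric group on $[n]$. For $\pi\in\mathfrak{S}_n$: $i\in[n-1]$ is a descent if $\pi(i)>\pi(i+1)$, $\mathrm{des}(\pi)$ the number of descents, $\mathrm{ides}(\pi)=\mathrm{des}(\pi^{-1})$; $i$ with $2\le i\le n-1$ is a peak if $\pi(i-1)<\pi(i)>\pi(i+1)$; $i\in[n-1]$ is a left peak if $i$ is a peak or if $i=1$ and $\pi(1)>\pi(2)$, $\mathrm{lpk}(\pi)$ the number of left peaks. $A_n(t)=\sum_{\pi\in\mathfrak{S}_n}t^{\mathrm{des}(\pi)+1}$ and $P_n^{\mathrm{lpk}}(t)=\sum_{\pi\in\mathfrak{S}_n}t^{\mathrm{lpk}(\pi)}$ for $n\ge1$, both equal to $1$ for $n=0$. $f(n,k,m)$ is the number of permutations in $\mathfrak{S}_n$ with exactly $k$ cycles of odd length and exactly $m$ cycles in total; it is $0$ when $n-k$ is odd. *)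

theory Defs
  imports Complex_Main "HOL-Combinatorics.Orbits"
begin

text \<open>
  The symmetric group on \<open>[n]\<close> consists of the functions on \<^typ>\<open>nat\<close> that permute \<open>{1..n}\<close> and
  are the identity elsewhere. Since such a function does not determine \<open>n\<close>, the permutation
  statistics take \<open>n\<close> as an argument.
\<close>

definition sym_perms :: "nat \<Rightarrow> (nat \<Rightarrow> nat) set" where
  "sym_perms n = {\<pi>. \<pi> permutes {1..n}}"

definition is_descent :: "nat \<Rightarrow> (nat \<Rightarrow> nat) \<Rightarrow> nat \<Rightarrow> bool" where
  "is_descent n \<pi> i \<longleftrightarrow> i \<in> {1..n - 1} \<and> \<pi> i > \<pi> (i + 1)"

definition des :: "nat \<Rightarrow> (nat \<Rightarrow> nat) \<Rightarrow> nat" where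
  "des n \<pi> = card {i. is_descent n \<pi> i}"

definition ides :: "nat \<Rightarrow> (nat \<Rightarrow> nat) \<Rightarrow> nat" where
  "ides n \<pi> = des n (inv \<pi>)"

definition is_peak :: "nat \<Rightarrow> (nat \<Rightarrow> nat) \<Rightarrow> nat \<Rightarrow> bool" where
  "is_peak n \<pi> i \<longleftrightarrow> i \<in> {2..n - 1} \<and> \<pi> (i - 1) < \<pi> i \<and> \<pi> i > \<pi> (i + 1)"

definition is_left_peak :: "nat \<Rightarrow> (nat \<Rightarrow> nat) \<Rightarrow> nat \<Rightarrow> bool" where
  "is_left_peak n \<pi> i \<longleftrightarrow> i \<in> {1..n - 1} \<and> (is_peak n \<pi> i \<or> (i = 1 \<and> \<pi> 1 > \<pi> 2))"

definition lpk :: "nat \<Rightarrow> (nat \<Rightarrow> nat) \<Rightarrow> nat" where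
  "lpk n \<pi> = card {i. is_left_peak n \<pi> i}"

definition A_poly :: "nat \<Rightarrow> 'a::comm_semiring_1 \<Rightarrow> 'a" where
  "A_poly n t = (if n = 0 then 1 else \<Sum>\<pi>\<in>sym_perms n. t ^ (des n \<pi> + 1))"

definition P_lpk :: "nat \<Rightarrow> 'a::comm_semiring_1 \<Rightarrow> 'a" where
  "P_lpk n t = (if n = 0 then 1 else \<Sum>\<pi>\<in>sym_perms n. t ^ lpk n \<pi>)"

definition P_lpk_ides :: "nat \<Rightarrow> 'a::comm_semiring_1 \<Rightarrow> 'a \<Rightarrow> 'a" where
  "P_lpk_ides n s t = (\<Sum>\<pi>\<in>sym_perms n. s ^ lpk n \<pi> * t ^ (ides n \<pi> + 1))"

text \<open>
  A cycle is represented by its underlying set, an orbit; fixed points are cycles of length 1.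
\<close>

definition cycles :: "nat \<Rightarrow> (nat \<Rightarrow> nat) \<Rightarrow> nat set set" where
  "cycles n \<pi> = orbit \<pi> ` {1..n}"

definition f_cyc :: "nat \<Rightarrow> nat \<Rightarrow> nat \<Rightarrow> nat" where
  "f_cyc n k m =
     card {\<pi> \<in> sym_perms n. card {C \<in> cycles n \<pi>. odd (card C)} = k \<and> card (cycles n \<pi>) = m}"

end

theory Submission
  imports Defs "HOL-Library.FuncSet" "HOL-Computational_Algebra.Polynomial_FPS"
begin

text \<open>
  Multiplying by \<open>1 / (1 - t)^(n+1)\<close> and extracting the coefficient of \<open>t^j\<close> replaces the pair
  \<open>(lpk, ides)\<close> on permutations by \<open>lpk\<close> on words of length \<open>n\<close> over \<open>j\<close> letters (standardization),
  and \<open>A\<^sub>m(t)\<close> by \<open>j^m\<close>. Substituting \<open>s = 4x / (1 + x)^2\<close> and extracting the coefficient of \<open>x^m\<close>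
  then turns \<open>s^lpk(w)\<close> into the number of weakly increasing labellings of the positions of \<open>w\<close> by
  \<open>0, ..., 2m\<close> in which equal even labels forbid a descent and equal odd labels force one, and
  \<open>P\<^sub>k(s)\<close> into \<open>(2m + 1)^k\<close>. A labelled word is a weakly increasing sequence over \<open>j (2m + 1)\<close> letters, of
  which \<open>j m\<close> may not be repeated, so it remains to identify the coefficients of
  \<open>F = (1 + x)^(jm) / (1 - x)^(j(m+1))\<close> with the cycle enumerator: both satisfy the recurrence encoded by
  \<open>(1 - x^2) F' = (j (2m + 1) + j x) F\<close>.
\<close>

unbundle fps_syntax

subsection \<open>Labellings compatible with a descent set\<close>

text \<open>One format covers three counts. With \<open>e\<close> constantly \<open>False\<close>,
  labels increase strictly at descents (P-partitions of a chain); with \<open>e = odd\<close>, they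
  are the enriched variant that detects left peaks; with \<open>d\<close> constantly
  \<open>False\<close>, labels satisfying \<open>e\<close> occur at most once and the others may
  repeat.\<close>

definition labellings :: "(nat \<Rightarrow> bool) \<Rightarrow> (nat \<Rightarrow> bool) \<Rightarrow> nat \<Rightarrow> nat \<Rightarrow> (nat \<Rightarrow> nat) set" where
  "labellings e d n M = {f \<in> {1..n} \<rightarrow>\<^sub>E {..<M}.
     \<forall>i\<in>{1..<n}. f i < f (Suc i) \<or> f i = f (Suc i) \<and> e (f i) = d i}"

text \<open>The recursion runs over the top label \<open>M\<close>. For \<open>n = 0\<close> the
  single position has no predecessor, and both values of the new bound give 1.\<close>

fun label_count :: "(nat \<Rightarrow> bool) \<Rightarrow> (nat \<Rightarrow> bool) \<Rightarrow> nat \<Rightarrow> nat \<Rightarrow> nat" where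
  "label_count e d 0 M = 1"
| "label_count e d (Suc n) 0 = 0"
| "label_count e d (Suc n) (Suc M) =
     label_count e d (Suc n) M + label_count e d n (if e M = d n then Suc M else M)"

lemma finite_labellings: "finite (labellings e d n M)"
  unfolding labellings_def by (rule finite_subset[OF _ finite_PiE[of "{1..n}" "\<lambda>_. {..<M}"]]) auto

lemma labellings_mono:
  assumes f: "f \<in> labellings e d n M" and i: "1 \<le> i" "i \<le> k" "k \<le> n"
  shows "f i \<le> f k"
  using i(2,3)
proof (induction k rule: dec_induct)
  case (step m)
  then have "m \<in> {1..<n}" using i(1) by simp
  then have "f m \<le> f (Suc m)" using f unfolding labellings_def by fastforce
  then show ?case using step by simp
qed simp

text \<open>Split by whether the last position carries the top label \<open>M\<close>. If so,
  deleting it leaves a labelling of the first \<open>n\<close> positions, which may still use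
  \<open>M\<close> exactly when a tie is allowed at \<open>n\<close>.\<close>

lemma labellings_Suc_Suc:
  "labellings e d (Suc n) (Suc M) = labellings e d (Suc n) M \<union>
     (\<lambda>g. g(Suc n := M)) ` labellings e d n (if e M = d n then Suc M else M)"
  (is "?L = ?A \<union> ?u ` ?B")
proof (intro equalityI subsetI)
  fix f assume f: "f \<in> ?L"
  have mono: "f i \<le> f k" if "1 \<le> i" "i \<le> k" "k \<le> Suc n" for i k
    using labellings_mono[OF f] that by blast
  have step: "f i < f (Suc i) \<or> f i = f (Suc i) \<and> e (f i) = d i" if "1 \<le> i" "i \<le> n" for i
    using f that by (auto simp: labellings_def)
  have lt: "f (Suc n) < Suc M" and ext: "f \<in> {1..Suc n} \<rightarrow>\<^sub>E {..<Suc M}"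
    using f by (auto simp: labellings_def PiE_iff)
  show "f \<in> ?A \<union> ?u ` ?B"
  proof (cases "f (Suc n) = M")
    case True
    \<comment> \<open>Resetting the deleted position to \<open>undefined\<close> keeps
      \<open>g\<close> extensional on \<open>{1..n}\<close>.\<close>
    define g where "g = f(Suc n := undefined)"
    have less: "f i < (if e M = d n then Suc M else M)" if "1 \<le> i" "i \<le> n" for i
      using step[of n] mono[of i n] mono[of i "Suc n"] that True by fastforce
    have "g \<in> {1..n} \<rightarrow>\<^sub>E {..<(if e M = d n then Suc M else M)}"
      using ext less by (auto simp: g_def PiE_iff extensional_def simp del: if_split)
    moreover have "\<forall>i\<in>{1..<n}. g i < g (Suc i) \<or> g i = g (Suc i) \<and> e (g i) = d i"
      using step by (auto simp: g_def)
    ultimately have "g \<in> ?B" by (simp add: labellings_def)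
    moreover have "f = ?u g" using True by (auto simp: g_def)
    ultimately show ?thesis by blast
  next
    case False
    have "f i < M" if "1 \<le> i" "i \<le> Suc n" for i
      using mono[of i "Suc n"] that False lt by simp
    then have "f \<in> ?A" using f by (auto simp: labellings_def PiE_iff)
    then show ?thesis by blast
  qed
next
  fix f assume "f \<in> ?A \<union> ?u ` ?B"
  then show "f \<in> ?L"
  proof
    assume "f \<in> ?A"
    then show ?thesis by (auto simp: labellings_def PiE_iff intro: less_SucI)
  next
    assume "f \<in> ?u ` ?B"
    then obtain g where g: "g \<in> ?B" and f: "f = g(Suc n := M)" by blast
    have gb: "g i < (if e M = d n then Suc M else M)" if "1 \<le> i" "i \<le> n" for i
      using g that by (auto simp: labellings_def PiE_iff)
    have "f i < f (Suc i) \<or> f i = f (Suc i) \<and> e (f i) = d i" if "1 \<le> i" "i \<le> n" for i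
    proof (cases "i = n")
      case True
      then show ?thesis using gb[of n] that f by (cases "g n = M") (auto split: if_splits)
    next
      case False
      then show ?thesis using g that f by (auto simp: labellings_def)
    qed
    moreover have "f i < Suc M" if "1 \<le> i" "i \<le> Suc n" for i
      using gb[of i] that f by (auto split: if_splits)
    moreover have "f i = undefined" if "\<not> (1 \<le> i \<and> i \<le> Suc n)" for i
      using g that f by (auto simp: labellings_def PiE_iff extensional_def)
    ultimately show ?thesis
      by (auto simp: labellings_def PiE_iff extensional_def)
  qed
qed

lemma card_labellings: "card (labellings e d n M) = label_count e d n M"
proof (induction e d n M rule: label_count.induct)
  case (1 e d M)
  then show ?case by (simp add: labellings_def)
next
  case (2 e d n)
  have "labellings e d (Suc n) 0 = {}" by (auto simp: labellings_def PiE_iff)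
  then show ?case by simp
next
  case (3 e d n M)
  let ?M = "if e M = d n then Suc M else M"
  have undef: "g (Suc n) = undefined" if "g \<in> labellings e d n ?M" for g
    using that by (auto simp: labellings_def PiE_iff extensional_def)
  have inj: "inj_on (\<lambda>g. g(Suc n := M)) (labellings e d n ?M)"
  proof (rule inj_onI)
    fix g h assume gh: "g \<in> labellings e d n ?M" "h \<in> labellings e d n ?M"
      and eq: "g(Suc n := M) = h(Suc n := M)"
    show "g = h"
    proof
      fix i
      show "g i = h i"
        using undef[OF gh(1)] undef[OF gh(2)] fun_cong[OF eq, of i] by (cases "i = Suc n") auto
    qed
  qed
  have disj: "labellings e d (Suc n) M \<inter> (\<lambda>g. g(Suc n := M)) ` labellings e d n ?M = {}"
  proof (rule ccontr)
    assume "\<not> ?thesis"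
    then obtain f g where "f \<in> labellings e d (Suc n) M" "f = g(Suc n := M)" by blast
    moreover from this have "f \<in> {1..Suc n} \<rightarrow>\<^sub>E {..<M}" by (simp add: labellings_def)
    then have "f (Suc n) \<in> {..<M}" by (rule PiE_mem) simp
    ultimately show False by simp
  qed
  show ?case
    unfolding labellings_Suc_Suc using 3
    by (subst card_Un_disjoint[OF finite_labellings finite_imageI[OF finite_labellings] disj])
       (simp add: card_image[OF inj])
qed


section \<open>Generating functions for descents and left peaks\<close>

lemma label_count_at_0: "n > 0 \<Longrightarrow> label_count e d n 0 = 0"
  by (cases n) auto

text \<open>Each further position divides the series by \<open>1 - fps_X\<close>, with an extra
  factor \<open>fps_X\<close> at a descent because the label must then grow strictly.\<close>

lemma descent_labelling_series:
  assumes "n \<ge> 1"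
  shows "(1 - fps_X) ^ Suc n * Abs_fps (\<lambda>j. of_nat (label_count (\<lambda>_. False) d n j) :: 'a::field_char_0)
    = fps_X ^ Suc (card {i\<in>{1..<n}. d i})"
  using assms
proof (induction n rule: dec_induct)
  case base
  let ?G = "\<lambda>n. Abs_fps (\<lambda>j. of_nat (label_count (\<lambda>_. False) d n j) :: 'a)"
  have "(1 - fps_X) * ?G 0 = 1" and "(1 - fps_X) * ?G 1 = fps_X * ?G 0"
    by (auto simp: fps_eq_iff left_diff_distrib fps_X_def[symmetric] split: nat.splits)
       (metis One_nat_def Suc_pred label_count.simps(1,3) of_nat_1 of_nat_add add_diff_cancel_left')+
  then have "(1 - fps_X) ^ Suc 1 * ?G 1 = fps_X"
    unfolding power_Suc power_one_right by algebra
  then show ?case by simp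
next
  case (step n)
  let ?G = "\<lambda>n. Abs_fps (\<lambda>j. of_nat (label_count (\<lambda>_. False) d n j) :: 'a)"
  \<comment> \<open>The coefficient at 0 needs \<open>label_count\<close> to vanish when there are
    no labels, which holds only for \<open>n \<ge> 1\<close>. The first position contributes
    \<open>fps_X\<close> anyway, whence the \<open>Suc\<close> in the exponent.\<close>
  have rec: "(1 - fps_X) * ?G (Suc n) = (if d n then fps_X else 1) * ?G n"
  proof (rule fps_ext)
    fix j
    show "((1 - fps_X) * ?G (Suc n)) $ j = ((if d n then fps_X else 1) * ?G n) $ j"
      using step.hyps by (cases j) (auto simp: left_diff_distrib label_count_at_0)
  qed
  have S: "{i\<in>{1..<Suc n}. d i} = (if d n then insert n {i\<in>{1..<n}. d i} else {i\<in>{1..<n}. d i})"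
    using step.hyps by (auto simp: less_Suc_eq)
  have "(1 - fps_X) ^ Suc (Suc n) * ?G (Suc n) = (1 - fps_X) ^ Suc n * ((1 - fps_X) * ?G (Suc n))"
    by (simp add: algebra_simps)
  also have "\<dots> = (if d n then fps_X else 1) * ((1 - fps_X) ^ Suc n * ?G n)"
    unfolding rec by (simp add: algebra_simps)
  also have "\<dots> = fps_X ^ Suc (card {i\<in>{1..<Suc n}. d i})"
    unfolding step.IH S by simp
  finally show ?case .
qed

text \<open>Left peaks are the starts of the maximal runs of consecutive descents, so they depend on
  the descent set alone. This form also makes sense for words with repeated letters.\<close>

definition peak_count :: "nat \<Rightarrow> (nat \<Rightarrow> bool) \<Rightarrow> nat" where
  "peak_count n d = card {i\<in>{1..<n}. d i \<and> (i = 1 \<or> \<not> d (i - 1))}"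

lemma peak_count_Suc:
  assumes "n \<ge> 1"
  shows "peak_count (Suc n) d = peak_count n d + (if d n \<and> (n = 1 \<or> \<not> d (n - 1)) then 1 else 0)"
proof -
  have "{i\<in>{1..<Suc n}. d i \<and> (i = 1 \<or> \<not> d (i - 1))} =
    (if d n \<and> (n = 1 \<or> \<not> d (n - 1)) then {n} else {}) \<union> {i\<in>{1..<n}. d i \<and> (i = 1 \<or> \<not> d (i - 1))}"
    using assms by (auto simp: less_Suc_eq)
  then show ?thesis unfolding peak_count_def by auto
qed

text \<open>
  The direction of the last step determines the ratio \<open>H / G\<close>, namely \<open>2 / (1 + x)\<close> after an ascent and
  \<open>(1 + x) / (2x)\<close> after a descent. Hence a step multiplies \<open>G\<close> by \<open>(1 + x) / (1 - x)\<close>, with the extra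
  factor \<open>4x / (1 + x)^2\<close> exactly when it completes a left peak.
\<close>

lemma peak_labelling_series_aux:
  fixes d :: "nat \<Rightarrow> bool"
  defines "G \<equiv> \<lambda>n. Abs_fps (\<lambda>m. of_nat (label_count odd d n (2 * m + 1)) :: 'a::field_char_0)"
    and "H \<equiv> \<lambda>n. Abs_fps (\<lambda>m. of_nat (label_count odd d n (2 * m + 2)) :: 'a::field_char_0)"
  assumes "n \<ge> 1"
  shows "G n * (1 - fps_X) ^ Suc n * (1 + fps_X) ^ (2 * peak_count n d)
      = (4 * fps_X) ^ peak_count n d * (1 + fps_X) ^ n \<and>
    (if n = 1 \<or> \<not> d (n - 1) then (1 + fps_X) * H n = 2 * G n else (1 + fps_X) * G n = 2 * fps_X * H n)"
proof -
  \<comment> \<open>In \<open>G\<close> the top label is even, in \<open>H\<close> odd. Adding the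
    labels \<open>2 * m\<close> and \<open>2 * m + 1\<close> one at a time gives two linear
    equations for \<open>G (Suc n)\<close> and \<open>H (Suc n)\<close>, which are then solved. The
    first position behaves like one after an ascent.\<close>
  have asc: "(1 - fps_X) * G (Suc n) = (1 + fps_X) * G n \<and> (1 - fps_X) * H (Suc n) = 2 * G n"
    if "n = 0 \<or> \<not> d n" for n
  proof -
    have "G (Suc n) $ m = (fps_X * H (Suc n) + G n) $ m" for m
      using that by (cases m) (auto simp: G_def H_def)
    then have "G (Suc n) = fps_X * H (Suc n) + G n" by (simp add: fps_eq_iff)
    moreover have "H (Suc n) $ m = (G (Suc n) + G n) $ m" for m
      using that by (auto simp: G_def H_def)
    then have "H (Suc n) = G (Suc n) + G n" by (simp add: fps_eq_iff)
    ultimately show ?thesis by algebra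
  qed
  \<comment> \<open>A descent allows ties at odd labels only. The coefficient at
    \<open>m = 0\<close> uses that \<open>label_count\<close> vanishes without labels, hence
    \<open>n \<ge> 1\<close>.\<close>
  have desc: "(1 - fps_X) * G (Suc n) = 2 * fps_X * H n \<and> (1 - fps_X) * H (Suc n) = (1 + fps_X) * H n"
    if "n \<ge> 1" "d n" for n
  proof -
    have "G (Suc n) $ m = (fps_X * H (Suc n) + fps_X * H n) $ m" for m
      using that by (cases m) (auto simp: G_def H_def label_count_at_0)
    then have "G (Suc n) = fps_X * H (Suc n) + fps_X * H n" by (simp add: fps_eq_iff)
    moreover have "H (Suc n) $ m = (G (Suc n) + H n) $ m" for m
      using that by (auto simp: G_def H_def)
    then have "H (Suc n) = G (Suc n) + H n" by (simp add: fps_eq_iff)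
    ultimately show ?thesis by algebra
  qed
  have ne: "1 - fps_X \<noteq> (0 :: 'a fps)" "1 + fps_X \<noteq> (0 :: 'a fps)"
    by (auto simp: fps_eq_iff intro!: exI[of _ 0])
  show ?thesis using \<open>n \<ge> 1\<close>
  proof (induction n rule: dec_induct)
    case base
    have "((1 - fps_X) * G 0) $ m = (1 :: 'a fps) $ m" for m
      by (cases m) (auto simp: G_def left_diff_distrib)
    then have G0: "(1 - fps_X) * G 0 = 1" by (simp add: fps_eq_iff)
    have A0: "(1 - fps_X) * G (Suc 0) = (1 + fps_X) * G 0" "(1 - fps_X) * H (Suc 0) = 2 * G 0"
      using asc[of 0] by auto
    have "(1 - fps_X) * ((1 + fps_X) * H 1) = (1 - fps_X) * (2 * G 1)"
      using A0 unfolding One_nat_def by algebra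
    then have "(1 + fps_X) * H 1 = 2 * G 1" using ne by simp
    moreover have "G 1 * (1 - fps_X) ^ 2 = 1 + fps_X"
      using A0(1) G0 unfolding One_nat_def by algebra
    ultimately show ?case by (simp add: peak_count_def numeral_2_eq_2)
  next
    case (step n)
    note IH = step.IH
    let ?p = "peak_count n d"
    have IH1: "G n * (1 - fps_X) ^ Suc n * (1 + fps_X) ^ (2 * ?p) = (4 * fps_X) ^ ?p * (1 + fps_X) ^ n"
      using IH by blast
    show ?case
    proof (cases "d n")
      case False
      have A: "(1 - fps_X) * G (Suc n) = (1 + fps_X) * G n" "(1 - fps_X) * H (Suc n) = 2 * G n"
        using asc[of n] False by auto
      have "(1 - fps_X) * ((1 + fps_X) * H (Suc n)) = (1 - fps_X) * (2 * G (Suc n))"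
        using A by algebra
      then have "(1 + fps_X) * H (Suc n) = 2 * G (Suc n)" using ne by simp
      moreover have "G (Suc n) * (1 - fps_X) ^ Suc (Suc n) * (1 + fps_X) ^ (2 * ?p)
        = ((1 - fps_X) * G (Suc n)) * (1 - fps_X) ^ Suc n * (1 + fps_X) ^ (2 * ?p)"
        by (simp add: algebra_simps)
      then have "G (Suc n) * (1 - fps_X) ^ Suc (Suc n) * (1 + fps_X) ^ (2 * ?p)
        = (1 + fps_X) * (G n * (1 - fps_X) ^ Suc n * (1 + fps_X) ^ (2 * ?p))"
        unfolding A(1) by (simp only: mult.assoc)
      then have "G (Suc n) * (1 - fps_X) ^ Suc (Suc n) * (1 + fps_X) ^ (2 * ?p) = (4 * fps_X) ^ ?p * (1 + fps_X) ^ Suc n"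
        unfolding IH1 by (simp only: power_Suc mult_ac)
      moreover have "peak_count (Suc n) d = ?p"
        using peak_count_Suc[OF step.hyps(1), of d] False by simp
      ultimately show ?thesis using False by simp
    next
      case True
      have D: "(1 - fps_X) * G (Suc n) = 2 * fps_X * H n" "(1 - fps_X) * H (Suc n) = (1 + fps_X) * H n"
        using desc[OF step.hyps(1) True] by auto
      have "(1 - fps_X) * ((1 + fps_X) * G (Suc n)) = (1 - fps_X) * (2 * fps_X * H (Suc n))"
        using D by algebra
      then have GH: "(1 + fps_X) * G (Suc n) = 2 * fps_X * H (Suc n)" using ne by simp
      have "G (Suc n) * (1 - fps_X) ^ Suc (Suc n) * (1 + fps_X) ^ (2 * peak_count (Suc n) d)
        = (4 * fps_X) ^ peak_count (Suc n) d * (1 + fps_X) ^ (Suc n)"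
      proof (cases "n = 1 \<or> \<not> d (n - 1)")
        case p: True
        have pc: "peak_count (Suc n) d = Suc ?p"
          using peak_count_Suc[OF step.hyps(1), of d] p True by auto
        have "(1 + fps_X) * H n = 2 * G n" using IH p by simp
        then have E: "(1 + fps_X) * ((1 - fps_X) * G (Suc n)) = 4 * fps_X * G n"
          unfolding D(1) by algebra
        have "G (Suc n) * (1 - fps_X) ^ Suc (Suc n) * (1 + fps_X) ^ (2 * peak_count (Suc n) d)
          = (1 + fps_X) * ((1 - fps_X) * G (Suc n)) * ((1 - fps_X) ^ Suc n * (1 + fps_X) ^ Suc (2 * ?p))"
          unfolding pc mult_Suc_right add_2_eq_Suc by (simp only: power_Suc mult_ac)
        also have "\<dots> = 4 * fps_X * (1 + fps_X) * (G n * (1 - fps_X) ^ Suc n * (1 + fps_X) ^ (2 * ?p))"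
          unfolding E by (simp only: power_Suc mult_ac)
        finally show ?thesis unfolding pc IH1 by (simp only: power_Suc mult_ac)
      next
        case p: False
        have pc: "peak_count (Suc n) d = ?p"
          using peak_count_Suc[OF step.hyps(1), of d] p True by auto
        have E: "(1 - fps_X) * G (Suc n) = (1 + fps_X) * G n"
          using D IH p by simp
        have "G (Suc n) * (1 - fps_X) ^ Suc (Suc n) * (1 + fps_X) ^ (2 * ?p)
          = (1 - fps_X) * G (Suc n) * ((1 - fps_X) ^ Suc n * (1 + fps_X) ^ (2 * ?p))"
          by (simp only: power_Suc mult_ac)
        also have "\<dots> = (1 + fps_X) * (G n * (1 - fps_X) ^ Suc n * (1 + fps_X) ^ (2 * ?p))"
          unfolding E by (simp only: mult_ac)
        finally show ?thesis unfolding pc IH1 by (simp only: power_Suc mult_ac)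
      qed
      then show ?thesis using GH True step.hyps by simp
    qed
  qed
qed

subsection \<open>Increasing sequences with repeatable letters\<close>

text \<open>A repeatable letter contributes a factor \<open>1 / (1 - X)\<close> to
  \<open>F M\<close>, any other letter a factor \<open>1 + X\<close>. The claim is the logarithmic
  derivative of this product with denominators cleared, obtained by adding one letter at a
  time.\<close>

lemma chain_series_deriv:
  fixes e :: "nat \<Rightarrow> bool"
  defines "F \<equiv> \<lambda>M. Abs_fps (\<lambda>n. of_nat (label_count e (\<lambda>_. False) n M) :: 'a::field_char_0)"
  shows "(1 - fps_X ^ 2) * fps_deriv (F M) =
    (of_nat (card {i. i < M \<and> \<not> e i}) * (1 + fps_X) + of_nat (card {i. i < M \<and> e i}) * (1 - fps_X)) * F M"
proof (induction M)
  case 0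
  have "F 0 $ n = (1 :: 'a fps) $ n" for n by (cases n) (auto simp: F_def)
  then have "F 0 = 1" by (simp add: fps_eq_iff)
  then show ?case by simp
next
  case (Suc M)
  let ?a = "of_nat (card {i. i < M \<and> \<not> e i}) :: 'a fps" and ?b = "of_nat (card {i. i < M \<and> e i}) :: 'a fps"
  have "F (Suc M) $ n = (F M + fps_X * (if e M then F M else F (Suc M))) $ n" for n
    by (cases n) (auto simp: F_def)
  then have rec: "F (Suc M) = F M + fps_X * (if e M then F M else F (Suc M))"
    by (simp add: fps_eq_iff)
  show ?case
  proof (cases "e M")
    case True
    have sets: "{i. i < Suc M \<and> e i} = insert M {i. i < M \<and> e i}"
      "{i. i < Suc M \<and> \<not> e i} = {i. i < M \<and> \<not> e i}"
      using True by (auto simp: less_Suc_eq)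
    have F: "F (Suc M) = (1 + fps_X) * F M" using rec True by (simp add: algebra_simps)
    have "fps_deriv (F (Suc M)) = (1 + fps_X) * fps_deriv (F M) + F M"
      unfolding F by simp
    then have "(1 - fps_X ^ 2) * fps_deriv (F (Suc M)) = (?a * (1 + fps_X) + (1 + ?b) * (1 - fps_X)) * F (Suc M)"
      using Suc F by algebra
    then show ?thesis unfolding sets by simp
  next
    case False
    have sets: "{i. i < Suc M \<and> e i} = {i. i < M \<and> e i}"
      "{i. i < Suc M \<and> \<not> e i} = insert M {i. i < M \<and> \<not> e i}"
      using False by (auto simp: less_Suc_eq)
    have F: "F M = (1 - fps_X) * F (Suc M)" using rec False by (simp add: algebra_simps)
    have "fps_deriv (F M) = (1 - fps_X) * fps_deriv (F (Suc M)) - F (Suc M)"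
      unfolding F by simp
    \<comment> \<open>Here \<open>F M\<close> is the multiple
      \<open>(1 - fps_X) * F (Suc M)\<close>, so the equation first appears with this extra factor,
      which is then cancelled.\<close>
    then have "(1 - fps_X) * ((1 - fps_X ^ 2) * fps_deriv (F (Suc M))) =
        (1 - fps_X) * (((1 + ?a) * (1 + fps_X) + ?b * (1 - fps_X)) * F (Suc M))"
      using Suc F by algebra
    moreover have "1 - fps_X \<noteq> (0 :: 'a fps)" by (auto simp: fps_eq_iff intro!: exI[of _ 0])
    ultimately have "(1 - fps_X ^ 2) * fps_deriv (F (Suc M)) = ((1 + ?a) * (1 + fps_X) + ?b * (1 - fps_X)) * F (Suc M)"
      by (simp only: mult_cancel_left) simp
    then show ?thesis unfolding sets by simp
  qed
qed

text \<open>Comparison of coefficients in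
  \<open>(1 - X^2) F' = ((a + b) + (a - b) X) F\<close>.\<close>

lemma chain_count_rec:
  fixes e :: "nat \<Rightarrow> bool" and M :: nat
  defines "c \<equiv> \<lambda>n. of_nat (label_count e (\<lambda>_. False) n M) :: 'a::field_char_0"
    and "a \<equiv> of_nat (card {i. i < M \<and> \<not> e i}) :: 'a" and "b \<equiv> of_nat (card {i. i < M \<and> e i}) :: 'a"
  shows "c 1 = a + b"
    and "of_nat (n + 2) * c (n + 2) = (a + b) * c (n + 1) + (of_nat n + (a - b)) * c n"
proof -
  define F where "F = Abs_fps c"
  have D: "fps_deriv F - fps_X * (fps_X * fps_deriv F) = fps_const (a + b) * F + fps_const (a - b) * (fps_X * F)"
    using chain_series_deriv[of e M, where 'a='a] unfolding F_def c_def a_def b_def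
    by (simp add: algebra_simps power2_eq_square fps_of_nat flip: fps_const_add fps_const_sub)
  show "c 1 = a + b"
    using arg_cong[OF D, of "\<lambda>f. f $ 0"] by (simp add: F_def c_def)
  have "(fps_deriv F - fps_X * (fps_X * fps_deriv F)) $ Suc n = of_nat (n + 2) * c (n + 2) - of_nat n * c n"
    by (cases n) (simp_all add: F_def)
  moreover have "(fps_const (a + b) * F + fps_const (a - b) * (fps_X * F)) $ Suc n = (a + b) * c (n + 1) + (a - b) * c n"
    by (simp add: F_def)
  ultimately have "of_nat (n + 2) * c (n + 2) - of_nat n * c n = (a + b) * c (n + 1) + (a - b) * c n"
    using D by metis
  then show "of_nat (n + 2) * c (n + 2) = (a + b) * c (n + 1) + (of_nat n + (a - b)) * c n"
    unfolding distrib_right[of "of_nat n"] by (metis add.left_commute add.commute diff_add_cancel)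
qed

subsection \<open>Permutations by cycle parity\<close>

lemma orbit_eq_of_mem:
  assumes f: "permutation f" and y: "y \<in> orbit f x"
  shows "orbit f x = orbit f y"
proof (intro equalityI subsetI)
  have x: "x \<in> orbit f y" using orbit_swap[OF permutation_self_in_orbit[OF f] y] .
  fix z
  show "z \<in> orbit f y" if "z \<in> orbit f x" using orbit_trans[OF that x] .
  show "z \<in> orbit f x" if "z \<in> orbit f y" using orbit_trans[OF that y] .
qed

text \<open>Composing with \<open>transpose a b\<close> inserts \<open>a\<close> into the cycle of
  \<open>b\<close> immediately before \<open>b\<close>: the former predecessor of \<open>b\<close>
  now maps to \<open>a\<close>, and \<open>a\<close> maps to \<open>b\<close>. All other cycles stay
  as they are.\<close>

lemma orbit_transpose_comp:
  assumes q: "q permutes S" and S: "finite S" and a: "a \<notin> S" and b: "b \<in> S"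
  defines "p \<equiv> transpose a b \<circ> q"
  shows "orbit p ` insert a S = insert (insert a (orbit q b)) (orbit q ` S - {orbit q b})"
proof -
  have pq: "permutation q" using q S by (auto simp: permutation_permutes)
  have pins: "p permutes insert a S"
    unfolding p_def using q b
    by (intro permutes_compose permutes_imp_permutes_insert permutes_swap_id) auto
  then have pp: "permutation p" using S by (auto simp: permutation_permutes)
  have qa: "q a = a" using q a by (simp add: permutes_def)
  have pa: "p a = b" by (simp add: p_def qa)
  have pb: "p x = (if q x = b then a else q x)" if "x \<in> S" for x
    using that a permutes_in_image[OF q, of x] by (auto simp: p_def transpose_def)
  have orbS: "orbit q x \<subseteq> S" if "x \<in> S" for x using permutes_orbit_subset[OF q that] .
  have self: "x \<in> orbit q x" "x \<in> orbit p x" for x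
    using permutation_self_in_orbit[OF pq] permutation_self_in_orbit[OF pp] by blast+
  have other: "orbit p x = orbit q x" if "x \<in> S" "b \<notin> orbit q x" for x
  proof (rule orbit_cong)
    show "x \<in> orbit q x" by (rule self)
    fix y assume y: "y \<in> orbit q x"
    have "q y \<in> orbit q x" using y by (rule orbit.step)
    then show "p y = q y" using pb[of y] y orbS[OF that(1)] that(2) by auto
  qed
  \<comment> \<open>Where \<open>q y = b\<close>, the map \<open>p\<close> detours through
    \<open>a\<close>; since \<open>b\<close> is in its own orbit, no element of the old cycle is
    lost.\<close>
  have "y \<in> orbit p b" if "y \<in> orbit q b" for y
    using that
  proof (induction rule: orbit.induct)
    case base
    then show ?case using pb[OF b] self(2)[of b] orbit.base[of p b] by (auto split: if_splits)
  next
    case (step y)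
    have "y \<in> S" using step orbS[OF b] by auto
    then show ?case using pb[of y] orbit.step[OF step.IH] self(2)[of b] by (auto split: if_splits)
  qed
  moreover have "b \<in> orbit p a" using orbit.base[of p a] pa by simp
  then have ab: "orbit p a = orbit p b" using orbit_eq_of_mem[OF pp] by blast
  ultimately have sub1: "insert a (orbit q b) \<subseteq> orbit p b" using self(2)[of a] by auto
  have "y \<in> insert a (orbit q b)" if "y \<in> orbit p b" for y
    using that
  proof (induction rule: orbit.induct)
    case base
    then show ?case using pb[OF b] orbit.base[of q b] by auto
  next
    case (step y)
    show ?case
    proof (cases "y = a")
      case True
      then show ?thesis using pa self(1)[of b] by simp
    next
      case False
      then have y: "y \<in> orbit q b" using step.IH by simp
      then have "p y = (if q y = b then a else q y)" using pb orbS[OF b] by blast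
      then show ?thesis using orbit.step[OF y] by simp
    qed
  qed
  then have ob: "orbit p b = insert a (orbit q b)" using sub1 by auto
  have same: "orbit p x = insert a (orbit q b)" if "x \<in> orbit q b" for x
    using that ob orbit_eq_of_mem[OF pp, of x b] by simp
  have in_iff: "b \<in> orbit q x \<longleftrightarrow> orbit q x = orbit q b" for x
    using orbit_eq_of_mem[OF pq, of b x] self(1)[of b] by auto
  show ?thesis
  proof (intro equalityI subsetI)
    fix C assume "C \<in> orbit p ` insert a S"
    then obtain x where x: "x \<in> insert a S" "C = orbit p x" by blast
    show "C \<in> insert (insert a (orbit q b)) (orbit q ` S - {orbit q b})"
    proof (cases "x = a \<or> b \<in> orbit q x")
      case True
      then have "C = insert a (orbit q b)" using x ab ob same[of x] in_iff[of x] self(1)[of x] by auto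
      then show ?thesis by simp
    next
      case False
      then show ?thesis using x other[of x] in_iff[of x] by auto
    qed
  next
    fix C assume "C \<in> insert (insert a (orbit q b)) (orbit q ` S - {orbit q b})"
    then consider "C = orbit p b" | x where "x \<in> S" "C = orbit q x" "C \<noteq> orbit q b"
      using ob by blast
    then show "C \<in> orbit p ` insert a S"
    proof cases
      case 2
      then have "C = orbit p x" using other[of x] in_iff[of x] by simp
      then show ?thesis using 2 by blast
    qed (use b in blast)
  qed
qed

lemma orbit_insert_fixpoint:
  assumes q: "q permutes S" and a: "a \<notin> S"
  shows "orbit q ` insert a S = insert {a} (orbit q ` S)"
proof -
  have "q a = a" using q a by (simp add: permutes_def)
  then have "orbit q a = {a}" by (simp add: orbit_eq_singleton_iff)
  then show ?thesis by simp
qed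

text \<open>The product ranges over a set of orbits, so a cycle contributes once, whatever its
  length.\<close>

definition cycle_weight :: "'a::comm_semiring_1 \<Rightarrow> 'a \<Rightarrow> ('b \<Rightarrow> 'b) \<Rightarrow> 'b set \<Rightarrow> 'a" where
  "cycle_weight x y p S = (\<Prod>C\<in>orbit p ` S. if odd (card C) then x else y)"

lemma cycle_weight_insert_fixpoint:
  assumes q: "q permutes S" and S: "finite S" and a: "a \<notin> S"
  shows "cycle_weight x y q (insert a S) = x * cycle_weight x y q S"
proof -
  have "{a} \<notin> orbit q ` S" using permutes_orbit_subset[OF q] a by fastforce
  then show ?thesis unfolding cycle_weight_def orbit_insert_fixpoint[OF q a]
    using S by (subst prod.insert) auto
qed

text \<open>Inserting \<open>a\<close> changes the parity of the cycle of \<open>b\<close>, which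
  exchanges its weights \<open>x\<close> and \<open>y\<close>.\<close>

lemma cycle_weight_transpose_comp:
  assumes q: "q permutes S" and S: "finite S" and a: "a \<notin> S" and b: "b \<in> S"
  shows "cycle_weight x y (transpose a b \<circ> q) (insert a S) =
    (if odd (card (orbit q b)) then y else x) *
      (\<Prod>C\<in>orbit q ` S - {orbit q b}. if odd (card C) then x else y)"
proof -
  have sub: "orbit q z \<subseteq> S" if "z \<in> S" for z using permutes_orbit_subset[OF q that] .
  have "insert a (orbit q b) \<notin> orbit q ` S - {orbit q b}" using sub a by fastforce
  moreover have "card (insert a (orbit q b)) = Suc (card (orbit q b))"
    using sub[OF b] a S by (meson card_insert_disjoint finite_subset in_mono)
  ultimately show ?thesis unfolding cycle_weight_def orbit_transpose_comp[OF assms]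
    using S by (subst prod.insert) auto
qed

text \<open>Two insertions into the same cycle restore its parity, so the weight is unchanged. The
  exception is \<open>c = b\<close>, where \<open>a\<close> and \<open>b\<close> form a new cycle of
  length 2.\<close>

lemma cycle_weight_two_step:
  assumes p: "p permutes R" and R: "finite R" and a: "a \<notin> insert b R" and b: "b \<notin> R" and c: "c \<in> insert b R"
  shows "cycle_weight x y (transpose a b \<circ> (transpose b c \<circ> p)) (insert a (insert b R)) =
    (if c = b then y else 1) * cycle_weight x y p R"
proof -
  let ?w = "\<lambda>C :: 'a set. if odd (card C) then x else y"
  let ?q = "transpose b c \<circ> p"
  have q: "?q permutes insert b R"
    using p c by (intro permutes_compose permutes_imp_permutes_insert permutes_swap_id) auto
  have fin: "finite (insert b R)" using R by simp
  have sub: "orbit p z \<subseteq> R" if "z \<in> R" for z using permutes_orbit_subset[OF p that] .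
  note W = cycle_weight_transpose_comp[OF q fin a insertI1, of x y]
  show ?thesis
  proof (cases "c = b")
    case True
    then have q: "?q = p" by simp
    have "p b = b" using p b by (simp add: permutes_def)
    then have ob: "orbit p b = {b}" by (simp add: orbit_eq_singleton_iff)
    have "{b} \<notin> orbit p ` R" using sub b by fastforce
    then show ?thesis using W True unfolding q orbit_insert_fixpoint[OF p b] ob
      by (simp add: cycle_weight_def)
  next
    case False
    then have c: "c \<in> R" using c by simp
    note O = orbit_transpose_comp[OF p R b c]
    \<comment> \<open>The set of orbits of \<open>?q\<close> is known; its member containing
      \<open>b\<close> must be the orbit of \<open>b\<close>.\<close>
    have "insert b (orbit p c) \<in> orbit ?q ` insert b R" using O by auto
    then obtain z where z: "insert b (orbit p c) = orbit ?q z" by blast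
    have "permutation ?q" using q fin by (auto simp: permutation_permutes)
    then have ob: "orbit ?q b = insert b (orbit p c)"
      using z orbit_eq_of_mem[of ?q b z] by (metis insertI1)
    have nin: "insert b (orbit p c) \<notin> orbit p ` R - {orbit p c}" using sub b by fastforce
    have cd: "card (insert b (orbit p c)) = Suc (card (orbit p c))"
      using sub[OF c] b R by (meson card_insert_disjoint finite_subset in_mono)
    have "cycle_weight x y p R = ?w (orbit p c) * (\<Prod>C\<in>orbit p ` R - {orbit p c}. ?w C)"
      unfolding cycle_weight_def using R c by (subst prod.remove[of _ "orbit p c"]) auto
    then show ?thesis using W False nin cd unfolding O ob by simp
  qed
qed

definition cycle_gen :: "'a::comm_semiring_1 \<Rightarrow> 'a \<Rightarrow> 'b set \<Rightarrow> 'a" where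
  "cycle_gen x y S = (\<Sum>p | p permutes S. cycle_weight x y p S)"

text \<open>Either \<open>a\<close> is fixed, or it maps to some \<open>b\<close>. In the second
  case remove both: \<open>b\<close> was then either alone with \<open>a\<close>, giving
  \<open>y\<close>, or inserted before one of the \<open>card S - 1\<close> other elements, at no
  change of weight.\<close>

lemma cycle_gen_insert2:
  assumes S: "finite S" and a: "a \<notin> S"
  shows "cycle_gen x y (insert a S) = x * cycle_gen x y S +
    (\<Sum>b\<in>S. (y + of_nat (card S - 1)) * cycle_gen x y (S - {b}))"
proof -
  have "cycle_gen x y (insert a S) = (\<Sum>b\<in>insert a S. \<Sum>q | q permutes S. cycle_weight x y (transpose a b \<circ> q) (insert a S))"
    unfolding cycle_gen_def by (rule sum_over_permutations_insert[OF S a])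
  also have "\<dots> = (\<Sum>q | q permutes S. cycle_weight x y q (insert a S)) +
    (\<Sum>b\<in>S. \<Sum>q | q permutes S. cycle_weight x y (transpose a b \<circ> q) (insert a S))"
    using S a by simp
  also have "(\<Sum>q | q permutes S. cycle_weight x y q (insert a S)) = x * cycle_gen x y S"
    unfolding cycle_gen_def sum_distrib_left using cycle_weight_insert_fixpoint[OF _ S a] by (intro sum.cong) auto
  also have "(\<Sum>b\<in>S. \<Sum>q | q permutes S. cycle_weight x y (transpose a b \<circ> q) (insert a S)) =
    (\<Sum>b\<in>S. (y + of_nat (card S - 1)) * cycle_gen x y (S - {b}))"
  proof (rule sum.cong[OF refl])
    fix b assume b: "b \<in> S"
    define R where "R = S - {b}"
    have R: "S = insert b R" "b \<notin> R" "finite R" "a \<notin> insert b R" using b S a by (auto simp: R_def)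
    have "(\<Sum>q | q permutes S. cycle_weight x y (transpose a b \<circ> q) (insert a S)) =
      (\<Sum>c\<in>insert b R. \<Sum>p | p permutes R. cycle_weight x y (transpose a b \<circ> (transpose b c \<circ> p)) (insert a (insert b R)))"
      unfolding R(1) by (rule sum_over_permutations_insert[OF R(3,2)])
    also have "\<dots> = (\<Sum>c\<in>insert b R. \<Sum>p | p permutes R. (if c = b then y else 1) * cycle_weight x y p R)"
      by (intro sum.cong refl cycle_weight_two_step) (use R in auto)
    also have "\<dots> = (\<Sum>c\<in>insert b R. if c = b then y else 1) * cycle_gen x y R"
      unfolding cycle_gen_def by (simp only: sum_distrib_left[symmetric] sum_distrib_right)
    also have "\<dots> = (y + (\<Sum>c\<in>R. 1)) * cycle_gen x y R"
    proof -
      have "(\<Sum>c\<in>R. if c = b then y else 1) = (\<Sum>c\<in>R. 1)"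
        using R by (intro sum.cong) auto
      then have "(\<Sum>c\<in>insert b R. if c = b then y else 1) = y + (\<Sum>c\<in>R. 1)"
        using R by simp
      then show ?thesis by simp
    qed
    also have "y + (\<Sum>c\<in>R. 1) = y + of_nat (card S - 1)" using R by simp
    finally show "(\<Sum>q | q permutes S. cycle_weight x y (transpose a b \<circ> q) (insert a S)) =
      (y + of_nat (card S - 1)) * cycle_gen x y (S - {b})" unfolding R_def .
  qed
  finally show ?thesis .
qed

text \<open>Divided by factorials, \<open>cycle_gen_insert2\<close> becomes
  \<open>chain_count_rec\<close>. In terms of the exponential formula,
  \<open>log ((1 + X)^b / (1 - X)^a)\<close> has coefficient \<open>(a + b) / k\<close> at
  \<open>X^k\<close> for odd \<open>k\<close> and \<open>(a - b) / k\<close> for even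
  \<open>k > 0\<close>.\<close>

lemma cycle_gen_chain_count:
  fixes e :: "nat \<Rightarrow> bool" and M :: nat
  defines "a \<equiv> of_nat (card {i. i < M \<and> \<not> e i}) :: 'a::field_char_0"
    and "b \<equiv> of_nat (card {i. i < M \<and> e i}) :: 'a"
  assumes "finite S" "card S = n"
  shows "cycle_gen (a + b) (a - b) S = fact n * of_nat (label_count e (\<lambda>_. False) n M)"
  using assms(3,4)
proof (induction n arbitrary: S rule: less_induct)
  case (less n)
  note R = chain_count_rec[where e=e and M=M and 'a='a, folded a_def b_def]
  show ?case
  proof (cases n)
    case 0
    then have "S = {}" using less.prems by simp
    then show ?thesis using 0 by (simp add: cycle_gen_def cycle_weight_def)
  next
    case (Suc k)
    then obtain z T where S: "S = insert z T" "z \<notin> T" "card T = k" "finite T"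
      using less.prems by (metis card_Suc_eq finite_insert)
    let ?c = "\<lambda>n. of_nat (label_count e (\<lambda>_. False) n M) :: 'a"
    have IHT: "cycle_gen (a + b) (a - b) T = fact k * ?c k"
      using less.IH[of k T] S Suc by simp
    have IHR: "cycle_gen (a + b) (a - b) (T - {u}) = fact (k - 1) * ?c (k - 1)" if "u \<in> T" for u
      using less.IH[of "k - 1" "T - {u}"] S Suc that by simp
    \<comment> \<open>For \<open>k = 0\<close> the factor \<open>of_nat k\<close> removes the second
      summand, so the truncated \<open>k - 1\<close> does no harm.\<close>
    have eq: "cycle_gen (a + b) (a - b) S = (a + b) * (fact k * ?c k) +
       of_nat k * (((a - b) + of_nat (k - 1)) * (fact (k - 1) * ?c (k - 1)))"
      unfolding S(1) cycle_gen_insert2[OF S(4,2)] using IHT IHR S by simp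
    show ?thesis
    proof (cases k)
      case 0
      then show ?thesis using eq Suc R(1) by simp
    next
      case (Suc l)
      have "fact (Suc (Suc l)) * ?c (l + 2) = fact (Suc l) * (of_nat (l + 2) * ?c (l + 2))"
        by (simp add: algebra_simps)
      also have "\<dots> = fact (Suc l) * ((a + b) * ?c (l + 1) + (of_nat l + (a - b)) * ?c l)"
        unfolding R(2) ..
      also have "\<dots> = cycle_gen (a + b) (a - b) S"
        unfolding eq using Suc by (simp add: algebra_simps)
      finally show ?thesis using Suc \<open>n = Suc k\<close> by simp
    qed
  qed
qed

subsection \<open>Standardization\<close>

lemma sym_perms_iff: "p \<in> sym_perms n \<longleftrightarrow> p permutes {1..n}"
  by (simp add: sym_perms_def)

text \<open>Ranks are strictly monotone in an injective key, hence distinct, and they lie between 1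
  and \<open>n\<close>.\<close>

lemma rank_permutes:
  fixes \<kappa> :: "nat \<Rightarrow> nat"
  assumes inj: "inj_on \<kappa> {1..n}"
  defines "r \<equiv> \<lambda>v. if v \<in> {1..n} then card {u\<in>{1..n}. \<kappa> u \<le> \<kappa> v} else v"
  shows "r permutes {1..n}" and "\<And>u v. u \<in> {1..n} \<Longrightarrow> v \<in> {1..n} \<Longrightarrow> r u < r v \<longleftrightarrow> \<kappa> u < \<kappa> v"
proof -
  have mono: "r u < r v" if "u \<in> {1..n}" "v \<in> {1..n}" "\<kappa> u < \<kappa> v" for u v
  proof -
    have "{w\<in>{1..n}. \<kappa> w \<le> \<kappa> u} \<subset> {w\<in>{1..n}. \<kappa> w \<le> \<kappa> v}"
      using that by (auto simp: psubset_eq set_eq_iff intro: exI[of _ v])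
    then have "card {w\<in>{1..n}. \<kappa> w \<le> \<kappa> u} < card {w\<in>{1..n}. \<kappa> w \<le> \<kappa> v}"
      by (intro psubset_card_mono) auto
    then show ?thesis using that unfolding r_def by simp
  qed
  show iff: "r u < r v \<longleftrightarrow> \<kappa> u < \<kappa> v" if "u \<in> {1..n}" "v \<in> {1..n}" for u v
    using mono[of u v] mono[of v u] that inj_onD[OF inj, of u v]
    by (metis less_asym linorder_less_linear less_irrefl)
  have "inj_on r {1..n}"
  proof (rule inj_onI)
    fix u v assume uv: "u \<in> {1..n}" "v \<in> {1..n}" "r u = r v"
    then have "\<kappa> u = \<kappa> v" using iff[of u v] iff[of v u] by simp
    then show "u = v" using inj uv by (simp add: inj_onD)
  qed
  moreover have "r ` {1..n} \<subseteq> {1..n}"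
  proof
    fix w assume "w \<in> r ` {1..n}"
    then obtain v where v: "v \<in> {1..n}" "w = card {u\<in>{1..n}. \<kappa> u \<le> \<kappa> v}" by (auto simp: r_def)
    have "card {v} \<le> w" "w \<le> card {1..n}"
      unfolding v(2) by (rule card_mono; use v(1) in auto)+
    then show "w \<in> {1..n}" by simp
  qed
  ultimately have "bij_betw r {1..n} {1..n}"
    by (simp add: bij_betw_def endo_inj_surj)
  then show "r permutes {1..n}"
    by (rule bij_imp_permutes) (auto simp: r_def)
qed

text \<open>The elements with key at most \<open>\<kappa> v\<close> are those with
  \<open>p u \<le> p v\<close>, and \<open>p\<close> maps them onto \<open>{1..p v}\<close>.\<close>

lemma rank_unique:
  fixes \<kappa> :: "nat \<Rightarrow> nat"
  assumes p: "p permutes {1..n}" and sorted: "\<And>u v. u \<in> {1..n} \<Longrightarrow> v \<in> {1..n} \<Longrightarrow> p u < p v \<longleftrightarrow> \<kappa> u < \<kappa> v"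
    and v: "v \<in> {1..n}"
  shows "p v = card {u\<in>{1..n}. \<kappa> u \<le> \<kappa> v}"
proof -
  have pv: "p v \<in> {1..n}" using permutes_in_image[OF p, of v] v by simp
  have "{u\<in>{1..n}. \<kappa> u \<le> \<kappa> v} = {u\<in>{1..n}. p u \<le> p v}"
    using sorted[OF v] by (auto simp: not_less[symmetric])
  also have "p ` \<dots> = {1..p v}"
  proof (intro equalityI subsetI)
    fix w assume "w \<in> {1..p v}"
    then have w: "w \<in> {1..n}" "w \<le> p v" using pv by auto
    then have "inv p w \<in> {1..n}" "p (inv p w) = w"
      using permutes_in_image[OF permutes_inv[OF p], of w] permutes_inverses(1)[OF p] by auto
    then show "w \<in> p ` {u\<in>{1..n}. p u \<le> p v}" using w by (metis (mono_tags, lifting) image_eqI mem_Collect_eq)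
  next
    fix w assume "w \<in> p ` {u\<in>{1..n}. p u \<le> p v}"
    then show "w \<in> {1..p v}" using permutes_in_image[OF p] by fastforce
  qed
  finally have "card {1..p v} = card (p ` {u\<in>{1..n}. \<kappa> u \<le> \<kappa> v})" by simp
  also have "\<dots> = card {u\<in>{1..n}. \<kappa> u \<le> \<kappa> v}"
    by (intro card_image inj_on_subset[OF permutes_inj[OF p]]) simp
  finally show ?thesis by simp
qed

text \<open>No length is built in, and the function may be a word; equal neighbours are then no
  descent.\<close>

definition descent :: "(nat \<Rightarrow> nat) \<Rightarrow> nat \<Rightarrow> bool" where
  "descent w i \<longleftrightarrow> w i > w (Suc i)"

text \<open>A number encoding the pair of \<open>l\<close> and \<open>v\<close> lexicographically,
  with the order of \<open>v\<close> reversed when \<open>e l\<close>. For \<open>v\<close> in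
  \<open>{1..n}\<close> the second part is at most \<open>n\<close>, so the factor
  \<open>Suc n\<close> separates labels.\<close>

definition label_key :: "(nat \<Rightarrow> bool) \<Rightarrow> nat \<Rightarrow> nat \<Rightarrow> nat \<Rightarrow> nat" where
  "label_key e n l v = l * Suc n + (if e l then n - v else v)"

lemma label_key_less_iff:
  assumes "u \<in> {1..n}" "v \<in> {1..n}"
  shows "label_key e n k u < label_key e n l v \<longleftrightarrow> k < l \<or> k = l \<and> (if e l then v < u else u < v)"
proof -
  have less: "label_key e n k u < label_key e n l v" if "k < l" "u \<in> {1..n}" "v \<in> {1..n}" for k l u v
  proof -
    have "label_key e n k u < Suc k * Suc n" using that by (auto simp: label_key_def)
    also have "\<dots> \<le> l * Suc n" using that by (intro mult_right_mono) auto
    also have "\<dots> \<le> label_key e n l v" by (simp add: label_key_def)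
    finally show ?thesis .
  qed
  consider "k < l" | "l < k" | "k = l" by linarith
  then show ?thesis
  proof cases
    case 1
    then show ?thesis using less assms by simp
  next
    case 2
    then have "\<not> label_key e n k u < label_key e n l v" using less[of l k v u] assms by simp
    then show ?thesis using 2 by simp
  next
    case 3
    then show ?thesis using assms by (auto simp: label_key_def)
  qed
qed

lemma label_key_inj:
  assumes "u \<in> {1..n}" "v \<in> {1..n}" "label_key e n k u = label_key e n l v"
  shows "u = v"
  using label_key_less_iff[OF assms(1,2), of e k l] label_key_less_iff[OF assms(2,1), of e l k] assms(3)
  by (auto split: if_splits)

text \<open>The local condition says that the key of \<open>(g i, \<rho> i)\<close> increases from
  each position to the next; transitivity turns this into sortedness of the whole sequence.\<close>

lemma labellings_descent_iff:
  assumes \<rho>: "\<rho> permutes {1..n}"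
  shows "g \<in> labellings e (descent \<rho>) n M \<longleftrightarrow> g \<in> {1..n} \<rightarrow>\<^sub>E {..<M} \<and>
    (\<forall>i\<in>{1..n}. \<forall>k\<in>{1..n}. i < k \<longleftrightarrow> label_key e n (g i) (\<rho> i) < label_key e n (g k) (\<rho> k))"
    (is "?L \<longleftrightarrow> ?E \<and> ?R")
proof -
  let ?\<kappa> = "\<lambda>i. label_key e n (g i) (\<rho> i)"
  have im: "\<rho> i \<in> {1..n}" if "i \<in> {1..n}" for i using permutes_in_image[OF \<rho>, of i] that by simp
  have ne: "\<rho> i \<noteq> \<rho> k" if "i \<noteq> k" for i k using permutes_inj[OF \<rho>] that by (simp add: inj_eq)
  \<comment> \<open>Since neighbouring values of \<open>\<rho>\<close> differ, a tie of labels is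
    decided by their order, in the direction prescribed by \<open>e\<close>.\<close>
  have adj: "(g i < g (Suc i) \<or> g i = g (Suc i) \<and> e (g i) = descent \<rho> i) \<longleftrightarrow> ?\<kappa> i < ?\<kappa> (Suc i)"
    if "i \<in> {1..<n}" for i
    using label_key_less_iff[of "\<rho> i" n "\<rho> (Suc i)" e "g i" "g (Suc i)"] im[of i] im[of "Suc i"] ne[of i "Suc i"] that
    unfolding descent_def by (metis Suc_n_not_n atLeastAtMost_iff atLeastLessThan_iff le_SucI less_eq_Suc_le less_imp_le_nat linorder_less_linear less_asym)
  have L: "?L \<longleftrightarrow> ?E \<and> (\<forall>i\<in>{1..<n}. ?\<kappa> i < ?\<kappa> (Suc i))"
    unfolding labellings_def mem_Collect_eq using adj by blast
  have "?R" if S: "\<forall>i\<in>{1..<n}. ?\<kappa> i < ?\<kappa> (Suc i)"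
  proof (intro ballI)
    have less: "?\<kappa> i < ?\<kappa> k" if "1 \<le> i" "i < k" "k \<le> n" for i k
      using that(2,3)
    proof (induction k)
      case (Suc k)
      then have "?\<kappa> k < ?\<kappa> (Suc k)" using S that(1) by simp
      then show ?case using Suc by (cases "i = k") auto
    qed simp
    fix i k assume "i \<in> {1..n}" "k \<in> {1..n}"
    then show "i < k \<longleftrightarrow> ?\<kappa> i < ?\<kappa> k"
      using less[of i k] less[of k i] by (cases i k rule: linorder_cases) auto
  qed
  moreover have "\<forall>i\<in>{1..<n}. ?\<kappa> i < ?\<kappa> (Suc i)" if ?R
  proof
    fix i assume "i \<in> {1..<n}"
    then have "i \<in> {1..n}" "Suc i \<in> {1..n}" by auto
    then show "?\<kappa> i < ?\<kappa> (Suc i)" using that by blast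
  qed
  ultimately show ?thesis using L by blast
qed

text \<open>Standardization as a bijection: a word \<open>h\<close> corresponds to the permutation
  \<open>\<rho>\<close> listing its positions by increasing key, together with the sorted word
  \<open>g = h \<circ> \<rho>\<close>. Thus \<open>label_count\<close> is the number of words
  belonging to \<open>\<rho>\<close>; constant statistics give \<open>M ^ n\<close>.\<close>

lemma sum_labellings_eq_sum_words:
  fixes \<Psi> :: "(nat \<Rightarrow> nat) \<Rightarrow> 'a::comm_semiring_1" and \<Phi> :: "(nat \<Rightarrow> nat) \<Rightarrow> 'a"
  assumes stat: "\<And>\<rho> g. \<rho> permutes {1..n} \<Longrightarrow> g \<in> labellings e (descent \<rho>) n M \<Longrightarrow> \<Psi> \<rho> = \<Phi> (g \<circ> inv \<rho>)"
  shows "(\<Sum>\<rho>\<in>sym_perms n. \<Psi> \<rho> * of_nat (label_count e (descent \<rho>) n M)) = (\<Sum>h\<in>{1..n} \<rightarrow>\<^sub>E {..<M}. \<Phi> h)"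
proof -
  define \<kappa> where "\<kappa> h v = label_key e n (h v) v" for h v
  define r where "r h = (\<lambda>v. if v \<in> {1..n} then card {u\<in>{1..n}. \<kappa> h u \<le> \<kappa> h v} else v)" for h
  have inj: "inj_on (\<kappa> h) {1..n}" for h
    unfolding \<kappa>_def by (rule inj_onI) (rule label_key_inj)
  have rp: "r h permutes {1..n}" for h unfolding r_def by (rule rank_permutes(1)[OF inj])
  have rs: "r h u < r h v \<longleftrightarrow> \<kappa> h u < \<kappa> h v" if "u \<in> {1..n}" "v \<in> {1..n}" for h u v
    unfolding r_def by (rule rank_permutes(2)[OF inj that])
  let ?P = "SIGMA \<rho>:sym_perms n. labellings e (descent \<rho>) n M"
  have fin: "finite (sym_perms n)" by (simp add: sym_perms_def finite_permutations)
  have "(\<Sum>\<rho>\<in>sym_perms n. \<Psi> \<rho> * of_nat (label_count e (descent \<rho>) n M)) =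
     (\<Sum>\<rho>\<in>sym_perms n. \<Sum>g\<in>labellings e (descent \<rho>) n M. \<Phi> (g \<circ> inv \<rho>))"
  proof (rule sum.cong[OF refl])
    fix \<rho> assume "\<rho> \<in> sym_perms n"
    then have "(\<Sum>g\<in>labellings e (descent \<rho>) n M. \<Phi> (g \<circ> inv \<rho>)) = (\<Sum>g\<in>labellings e (descent \<rho>) n M. \<Psi> \<rho>)"
      by (intro sum.cong refl stat[symmetric]) (auto simp: sym_perms_iff)
    then show "\<Psi> \<rho> * of_nat (label_count e (descent \<rho>) n M) = (\<Sum>g\<in>labellings e (descent \<rho>) n M. \<Phi> (g \<circ> inv \<rho>))"
      by (simp add: card_labellings mult.commute)
  qed
  also have "\<dots> = (\<Sum>(\<rho>, g)\<in>?P. \<Phi> (g \<circ> inv \<rho>))"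
    by (rule sum.Sigma) (simp_all add: fin finite_labellings)
  also have "\<dots> = (\<Sum>h\<in>{1..n} \<rightarrow>\<^sub>E {..<M}. \<Phi> h)"
  proof (rule sum.reindex_bij_witness[where i = "\<lambda>h. (inv (r h), h \<circ> inv (r h))" and j = "\<lambda>(\<rho>, g). g \<circ> inv \<rho>"])
    fix x assume "x \<in> ?P"
    then obtain \<rho> g where x: "x = (\<rho>, g)" and \<rho>: "\<rho> permutes {1..n}" and g: "g \<in> labellings e (descent \<rho>) n M"
      by (auto simp: sym_perms_iff)
    let ?h = "g \<circ> inv \<rho>"
    have i\<rho>: "inv \<rho> permutes {1..n}" using permutes_inv[OF \<rho>] .
    have im: "inv \<rho> v \<in> {1..n}" if "v \<in> {1..n}" for v using permutes_in_image[OF i\<rho>, of v] that by simp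
    note G = g[unfolded labellings_descent_iff[OF \<rho>]]
    \<comment> \<open>By uniqueness of ranks, this order property identifies
      \<open>inv \<rho>\<close> with \<open>r ?h\<close>, so \<open>\<rho>\<close> is recovered from
      the word.\<close>
    have sorted: "inv \<rho> u < inv \<rho> v \<longleftrightarrow> \<kappa> ?h u < \<kappa> ?h v" if "u \<in> {1..n}" "v \<in> {1..n}" for u v
      using G im[OF that(1)] im[OF that(2)] by (simp add: \<kappa>_def permutes_inverses(1)[OF \<rho>])
    have "r ?h v = inv \<rho> v" for v
      using rank_unique[OF i\<rho> sorted, of v] permutes_not_in[OF i\<rho>, of v] by (auto simp: r_def)
    then have "r ?h = inv \<rho>" by blast
    then show "(\<lambda>h. (inv (r h), h \<circ> inv (r h))) (case x of (\<rho>, g) \<Rightarrow> g \<circ> inv \<rho>) = x"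
      using x permutes_inv_inv[OF \<rho>] permutes_inv_o(2)[OF \<rho>] by (simp add: comp_assoc)
    have "?h v = undefined" if "v \<notin> {1..n}" for v
      using G that permutes_not_in[OF i\<rho> that] by (auto simp: PiE_iff extensional_def)
    moreover have "?h v \<in> {..<M}" if "v \<in> {1..n}" for v
      using G im[OF that] by (auto simp: PiE_iff)
    ultimately show "(case x of (\<rho>, g) \<Rightarrow> g \<circ> inv \<rho>) \<in> {1..n} \<rightarrow>\<^sub>E {..<M}"
      using x by (auto simp: PiE_iff extensional_def)
  next
    fix h assume h: "h \<in> {1..n} \<rightarrow>\<^sub>E {..<M}"
    let ?\<rho> = "inv (r h)"
    have \<rho>: "?\<rho> permutes {1..n}" using permutes_inv[OF rp] .
    have im: "?\<rho> v \<in> {1..n}" if "v \<in> {1..n}" for v using permutes_in_image[OF \<rho>, of v] that by simp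
    have inv: "inv ?\<rho> = r h" using permutes_inv_inv[OF rp] .
    show "(case (?\<rho>, h \<circ> ?\<rho>) of (\<rho>, g) \<Rightarrow> g \<circ> inv \<rho>) = h"
      using permutes_inv_o(2)[OF rp, of h] by (simp add: inv comp_assoc)
    have "(h \<circ> ?\<rho>) v = undefined" if "v \<notin> {1..n}" for v
      using h that permutes_not_in[OF \<rho> that] by (auto simp: PiE_iff extensional_def)
    moreover have "(h \<circ> ?\<rho>) v \<in> {..<M}" if "v \<in> {1..n}" for v
      using h im[OF that] by (auto simp: PiE_iff)
    ultimately have "h \<circ> ?\<rho> \<in> {1..n} \<rightarrow>\<^sub>E {..<M}"
      by (auto simp: PiE_iff extensional_def)
    moreover have "i < k \<longleftrightarrow> label_key e n ((h \<circ> ?\<rho>) i) (?\<rho> i) < label_key e n ((h \<circ> ?\<rho>) k) (?\<rho> k)"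
      if "i \<in> {1..n}" "k \<in> {1..n}" for i k
      using rs[OF im[OF that(1)] im[OF that(2)], of h] by (simp add: \<kappa>_def permutes_inverses(1)[OF rp])
    ultimately have "h \<circ> ?\<rho> \<in> labellings e (descent ?\<rho>) n M"
      unfolding labellings_descent_iff[OF \<rho>] by blast
    then show "(?\<rho>, h \<circ> ?\<rho>) \<in> ?P" using \<rho> by (simp add: sym_perms_iff)
  qed auto
  finally show ?thesis .
qed

subsection \<open>Labelled words\<close>

text \<open>
  Within a block of constant label the letters are reversed when the label forces descents, so that labelled
  words become weakly increasing sequences.
\<close>

definition encode_letter :: "(nat \<Rightarrow> bool) \<Rightarrow> nat \<Rightarrow> nat \<Rightarrow> nat \<Rightarrow> nat" where
  "encode_letter e j f w = f * j + (if e f then j - 1 - w else w)"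

definition decode_letter :: "(nat \<Rightarrow> bool) \<Rightarrow> nat \<Rightarrow> nat \<Rightarrow> nat" where
  "decode_letter e j l = (if e (l div j) then j - 1 - l mod j else l mod j)"

lemma encode_letter_div: "w < j \<Longrightarrow> encode_letter e j f w div j = f"
  unfolding encode_letter_def using div_mult_self3[of j f "if e f then j - 1 - w else w"] by (auto simp del: div_mult_self3)

lemma encode_letter_mod: "w < j \<Longrightarrow> encode_letter e j f w mod j = (if e f then j - 1 - w else w)"
  unfolding encode_letter_def mod_mult_self3 by (rule mod_less) auto

lemma decode_encode_letter: "w < j \<Longrightarrow> decode_letter e j (encode_letter e j f w) = w"
  unfolding decode_letter_def by (simp add: encode_letter_div encode_letter_mod)

lemma encode_decode_letter:
  assumes "j > 0"
  shows "encode_letter e j (l div j) (decode_letter e j l) = l"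
proof -
  have "j - 1 - (j - 1 - l mod j) = l mod j" using mod_less_divisor[OF assms, of l] by linarith
  then show ?thesis
    using div_mult_mod_eq[of l j] by (simp add: encode_letter_def decode_letter_def del: diff_diff_left)
qed

lemma decode_letter_less: "j > 0 \<Longrightarrow> decode_letter e j l < j"
  unfolding decode_letter_def by auto

lemma encode_letter_less:
  assumes "w < j" "f < q"
  shows "encode_letter e j f w < q * j"
proof -
  have "encode_letter e j f w < Suc f * j" using assms by (auto simp: encode_letter_def)
  also have "\<dots> \<le> q * j" using assms by (intro mult_right_mono) auto
  finally show ?thesis .
qed

text \<open>Equal codes mean equal labels and equal letters, hence no descent; this is admissible
  exactly when the label does not force one. Otherwise the reversal inside a block turns required
  descents into strict increase.\<close>

lemma encode_letter_step:
  assumes "v < j" "w < j"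
  shows "(encode_letter e j f v < encode_letter e j g w \<or> encode_letter e j f v = encode_letter e j g w \<and> \<not> e f)
    \<longleftrightarrow> f < g \<or> f = g \<and> e f = (w < v)"
proof -
  have less: "encode_letter e j f v < encode_letter e j g w" if "f < g" "v < j" "w < j" for f g v w
  proof -
    have "encode_letter e j f v < g * j" using encode_letter_less[OF that(2,1)] .
    also have "\<dots> \<le> encode_letter e j g w" by (simp add: encode_letter_def)
    finally show ?thesis .
  qed
  consider "f < g" | "g < f" | "f = g" by linarith
  then show ?thesis
  proof cases
    case 2
    then show ?thesis using less[of g f w v] assms by auto
  next
    case 3
    then show ?thesis using assms by (auto simp: encode_letter_def)
  qed (use less assms in auto)
qed

text \<open>A word and a compatible labelling merge into one increasing sequence over
  \<open>q\<close> blocks of \<open>j\<close> letters, whose non-repeatable letters fill the blocks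
  with \<open>e\<close>.\<close>

lemma sum_words_label_count:
  "(\<Sum>w\<in>{1..n} \<rightarrow>\<^sub>E {..<j}. label_count e (descent w) n q) =
    label_count (\<lambda>l. e (l div j)) (\<lambda>_. False) n (q * j)"
proof -
  let ?W = "{1..n} \<rightarrow>\<^sub>E {..<j}"
  let ?P = "SIGMA w:?W. labellings e (descent w) n q"
  let ?L = "labellings (\<lambda>l. e (l div j)) (\<lambda>_. False) n (q * j)"
  let ?f = "\<lambda>(w, f). \<lambda>i\<in>{1..n}. encode_letter e j (f i) (w i)"
  let ?g = "\<lambda>l. (\<lambda>i\<in>{1..n}. decode_letter e j (l i), \<lambda>i\<in>{1..n}. l i div j)"
  have "(\<Sum>w\<in>?W. label_count e (descent w) n q) = card ?P"
    by (subst card_SigmaI) (auto simp: finite_PiE finite_labellings card_labellings)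
  also have "card ?P = card ?L"
  proof (rule bij_betw_same_card[of ?f], rule bij_betw_byWitness[where f' = ?g])
    show "\<forall>x\<in>?P. ?g (?f x) = x"
    proof
      fix x assume "x \<in> ?P"
      then obtain w f where x: "x = (w, f)" "w \<in> ?W" "f \<in> {1..n} \<rightarrow>\<^sub>E {..<q}"
        by (auto simp: labellings_def)
      have "restrict (\<lambda>i. decode_letter e j (restrict (\<lambda>i. encode_letter e j (f i) (w i)) {1..n} i)) {1..n} = w"
        using x by (intro ext) (auto simp: restrict_def PiE_iff extensional_def decode_encode_letter)
      moreover have "restrict (\<lambda>i. restrict (\<lambda>i. encode_letter e j (f i) (w i)) {1..n} i div j) {1..n} = f"
        using x by (intro ext) (auto simp: restrict_def PiE_iff extensional_def encode_letter_div)
      ultimately show "?g (?f x) = x" using x(1) by simp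
    qed
    show "\<forall>l\<in>?L. ?f (?g l) = l"
    proof
      fix l assume "l \<in> ?L"
      then have l: "l \<in> {1..n} \<rightarrow>\<^sub>E {..<q * j}" by (auto simp: labellings_def)
      \<comment> \<open>The existence of a position carrying a value below \<open>q * j\<close>
        rules out \<open>j = 0\<close>, as decoding requires.\<close>
      then have "j > 0" if "i \<in> {1..n}" for i using that by (cases j) (auto simp: PiE_iff)
      then show "?f (?g l) = l"
        using l by (intro ext) (auto simp: restrict_def PiE_iff extensional_def encode_decode_letter)
    qed
    show "?f ` ?P \<subseteq> ?L"
    proof
      fix l assume "l \<in> ?f ` ?P"
      then obtain w f where w: "w \<in> ?W" and f: "f \<in> labellings e (descent w) n q" and l: "l = ?f (w, f)"
        by auto
      have wj: "w i < j" if "i \<in> {1..n}" for i using w that by (auto simp: PiE_iff)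
      have fq: "f i < q" if "i \<in> {1..n}" for i using f that by (auto simp: labellings_def PiE_iff)
      have "l i < l (Suc i) \<or> l i = l (Suc i) \<and> e (l i div j) = False" if i: "i \<in> {1..<n}" for i
      proof -
        have ii: "i \<in> {1..n}" "Suc i \<in> {1..n}" using i by auto
        have "f i < f (Suc i) \<or> f i = f (Suc i) \<and> e (f i) = (w (Suc i) < w i)"
          using f i by (simp add: labellings_def descent_def)
        then show ?thesis
          using encode_letter_step[OF wj[OF ii(1)] wj[OF ii(2)], of e "f i" "f (Suc i)"] ii
            encode_letter_div[OF wj[OF ii(1)], of e "f i"]
          unfolding l by simp
      qed
      moreover have "l \<in> {1..n} \<rightarrow>\<^sub>E {..<q * j}"
        unfolding l using encode_letter_less wj fq by (auto simp: PiE_iff)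
      ultimately show "l \<in> ?L" by (simp add: labellings_def)
    qed
    show "?g ` ?L \<subseteq> ?P"
    proof
      fix x assume "x \<in> ?g ` ?L"
      then obtain l where L: "l \<in> ?L" and x: "x = ?g l" by auto
      have lE: "l i < q * j" if "i \<in> {1..n}" for i using L that by (auto simp: labellings_def PiE_iff)
      have j: "j > 0" if "i \<in> {1..n}" for i using lE[OF that] by (cases j) auto
      have "fst x \<in> ?W" unfolding x using j by (auto simp: decode_letter_less)
      moreover have "snd x \<in> {1..n} \<rightarrow>\<^sub>E {..<q}"
        unfolding x using lE by (auto simp: less_mult_imp_div_less)
      moreover have "snd x i < snd x (Suc i) \<or> snd x i = snd x (Suc i) \<and> e (snd x i) = descent (fst x) i"
        if i: "i \<in> {1..<n}" for i
      proof -
        have ii: "i \<in> {1..n}" "Suc i \<in> {1..n}" using i by auto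
        have "l i < l (Suc i) \<or> l i = l (Suc i) \<and> \<not> e (l i div j)"
          using L i by (auto simp: labellings_def)
        then show ?thesis
          using encode_letter_step[of "decode_letter e j (l i)" j "decode_letter e j (l (Suc i))" e "l i div j" "l (Suc i) div j"]
            j[OF ii(1)] ii
          unfolding x by (simp add: decode_letter_less encode_decode_letter descent_def)
      qed
      ultimately have "fst x \<in> ?W" "snd x \<in> labellings e (descent (fst x)) n q"
        by (simp_all add: labellings_def)
      then show "x \<in> ?P" by (metis SigmaI prod.collapse)
    qed
  qed
  finally show ?thesis by (simp add: card_labellings)
qed

lemma card_div_less: "card {i. i < q * j \<and> P (i div j)} = j * card {k. k < q \<and> P k}"
proof (induction q)
  case (Suc q)
  show ?case
  proof (cases "j = 0")
    case False
    have block: "i div j = q" if "q * j \<le> i" "i < Suc q * j" for i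
      using that False by (intro div_nat_eqI) (auto simp: algebra_simps)
    have "{i. i < Suc q * j \<and> P (i div j)} =
      {i. i < q * j \<and> P (i div j)} \<union> (if P q then {q * j..<Suc q * j} else {})"
    proof (intro set_eqI iffI)
      fix i assume "i \<in> {i. i < Suc q * j \<and> P (i div j)}"
      then show "i \<in> {i. i < q * j \<and> P (i div j)} \<union> (if P q then {q * j..<Suc q * j} else {})"
        using block[of i] by (cases "i < q * j") auto
    next
      fix i assume "i \<in> {i. i < q * j \<and> P (i div j)} \<union> (if P q then {q * j..<Suc q * j} else {})"
      then show "i \<in> {i. i < Suc q * j \<and> P (i div j)}"
        using block[of i] by (auto split: if_splits)
    qed
    moreover have "{k. k < Suc q \<and> P k} = {k. k < q \<and> P k} \<union> (if P q then {q} else {})"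
      by (auto simp: less_Suc_eq)
    moreover have "card ({i. i < q * j \<and> P (i div j)} \<union> {q * j..<Suc q * j}) =
      card {i. i < q * j \<and> P (i div j)} + j"
      by (subst card_Un_disjoint) auto
    ultimately show ?thesis using Suc by (cases "P q") auto
  qed simp
qed simp

lemma card_parity_less:
  "card {k. k < 2 * m + 1 \<and> odd k} = m" "card {k. k < 2 * m + 1 \<and> \<not> odd k} = m + 1"
proof -
  have "{k. k < 2 * m + 1 \<and> odd k} = (\<lambda>i. 2 * i + 1) ` {..<m}" by (auto elim!: oddE)
  then show "card {k. k < 2 * m + 1 \<and> odd k} = m" by (simp add: card_image inj_on_def)
  have "{k. k < 2 * m + 1 \<and> \<not> odd k} = (\<lambda>i. 2 * i) ` {..<m + 1}" by (auto elim!: evenE)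
  then show "card {k. k < 2 * m + 1 \<and> \<not> odd k} = m + 1" by (simp add: card_image inj_on_def)
qed

section \<open>Cycle statistics and left peaks\<close>

definition odd_cycle_count :: "nat \<Rightarrow> (nat \<Rightarrow> nat) \<Rightarrow> nat" where
  "odd_cycle_count n p = card {C \<in> cycles n p. odd (card C)}"

lemma finite_cycles: "finite (cycles n p)"
  by (simp add: cycles_def)

text \<open>With the odd weight written as \<open>x * y\<close>, the variable \<open>y\<close> marks
  all cycles and \<open>x\<close> only the odd ones.\<close>

lemma cycle_weight_eq_powers:
  "cycle_weight (x * y) y p {1..n} = x ^ odd_cycle_count n p * y ^ card (cycles n p)"
proof -
  have "cycle_weight (x * y) y p {1..n} = (\<Prod>C\<in>cycles n p. (if odd (card C) then x else 1) * y)"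
    unfolding cycle_weight_def cycles_def by (intro prod.cong) auto
  also have "\<dots> = (\<Prod>C\<in>cycles n p. if odd (card C) then x else 1) * y ^ card (cycles n p)"
    by (simp add: prod.distrib)
  also have "(\<Prod>C\<in>cycles n p. if odd (card C) then x else 1) = (\<Prod>C | C \<in> cycles n p \<and> odd (card C). x)"
    using prod.inter_filter[OF finite_cycles, of "\<lambda>_. x" n p "\<lambda>C. odd (card C)"] by simp
  also have "\<dots> = x ^ odd_cycle_count n p" by (simp add: odd_cycle_count_def)
  finally show ?thesis .
qed

text \<open>There are \<open>a = j * (m + 1)\<close> repeatable and \<open>b = j * m\<close>
  non-repeatable letters, so an odd cycle has weight \<open>a + b = (2 * m + 1) * j\<close> and an
  even one \<open>a - b = j\<close>.\<close>

lemma sum_words_peak_labellings: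
  "fact n * of_nat (\<Sum>w\<in>{1..n} \<rightarrow>\<^sub>E {..<j}. label_count odd (descent w) n (2 * m + 1)) =
    (\<Sum>p\<in>sym_perms n. of_nat (2 * m + 1) ^ odd_cycle_count n p * of_nat j ^ card (cycles n p) :: 'a::field_char_0)"
proof -
  let ?e = "\<lambda>l. odd (l div j)" and ?M = "(2 * m + 1) * j"
  have c: "card {i. i < ?M \<and> \<not> ?e i} = j * (m + 1)" "card {i. i < ?M \<and> ?e i} = j * m"
    using card_div_less[of "2 * m + 1" j "\<lambda>k. \<not> odd k"] card_div_less[of "2 * m + 1" j odd]
    unfolding card_parity_less by simp_all
  have "fact n * of_nat (\<Sum>w\<in>{1..n} \<rightarrow>\<^sub>E {..<j}. label_count odd (descent w) n (2 * m + 1)) =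
    (fact n * of_nat (label_count ?e (\<lambda>_. False) n ?M) :: 'a)"
    unfolding sum_words_label_count ..
  also have "\<dots> = cycle_gen (of_nat (j * (m + 1)) + of_nat (j * m)) (of_nat (j * (m + 1)) - of_nat (j * m)) {1..n}"
    using cycle_gen_chain_count[of "{1..n}" n ?M ?e, where 'a='a] unfolding c by simp
  also have "\<dots> = cycle_gen (of_nat (2 * m + 1) * of_nat j) (of_nat j) {1..n}"
    by (simp add: algebra_simps)
  also have "\<dots> = (\<Sum>p\<in>sym_perms n. of_nat (2 * m + 1) ^ odd_cycle_count n p * of_nat j ^ card (cycles n p))"
    unfolding cycle_gen_def cycle_weight_eq_powers sym_perms_def ..
  finally show ?thesis .
qed

text \<open>The cycles partition \<open>{1..n}\<close>, so \<open>n\<close> has the parity of the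
  number of odd cycles. Hence the later \<open>div 2\<close> is exact.\<close>

lemma odd_cycle_count_parity:
  assumes p: "p permutes {1..n}"
  shows "odd_cycle_count n p \<le> n" "even (n - odd_cycle_count n p)" "card (cycles n p) \<le> n"
proof -
  have perm: "permutation p" using p by (auto simp: permutation_permutes)
  have U: "\<Union> (cycles n p) = {1..n}"
    using permutes_orbit_subset[OF p] permutation_self_in_orbit[OF perm] unfolding cycles_def by blast
  have "pairwise disjnt (cycles n p)"
  proof (rule pairwiseI)
    fix C D assume "C \<in> cycles n p" "D \<in> cycles n p" "C \<noteq> D"
    then obtain x y where xy: "C = orbit p x" "D = orbit p y" "orbit p x \<noteq> orbit p y" by (auto simp: cycles_def)
    have False if "z \<in> orbit p x" "z \<in> orbit p y" for z
      using orbit_eq_of_mem[OF perm that(1)] orbit_eq_of_mem[OF perm that(2)] xy(3) by simp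
    then show "disjnt C D" using xy by (auto simp: disjnt_def)
  qed
  moreover have "finite C" if "C \<in> cycles n p" for C
    using that U by (metis Union_upper finite_atLeastAtMost finite_subset)
  ultimately have "n = (\<Sum>C\<in>cycles n p. card C)"
    using card_Union_disjoint[of "cycles n p"] U by simp
  then have ev: "even n \<longleftrightarrow> even (odd_cycle_count n p)"
    using even_sum_iff[OF finite_cycles, of card n p] unfolding odd_cycle_count_def by simp
  show card: "card (cycles n p) \<le> n"
    unfolding cycles_def using card_image_le[of "{1..n}" "orbit p"] by simp
  have "odd_cycle_count n p \<le> card (cycles n p)"
    unfolding odd_cycle_count_def by (intro card_mono finite_cycles) auto
  then show le: "odd_cycle_count n p \<le> n" using card by simp
  show "even (n - odd_cycle_count n p)" using ev le by simp
qed

lemma lpk_eq_peak_count: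
  assumes p: "p permutes {1..n}"
  shows "lpk n p = peak_count n (descent p)"
proof -
  \<comment> \<open>Injectivity makes a non-descent a strict ascent, as the definition of a peak
    demands.\<close>
  have ne: "p (i - 1) < p i \<longleftrightarrow> \<not> p i < p (i - 1)" if "i \<ge> 1" for i
    using permutes_inj[OF p] that by (metis Suc_n_not_n Suc_pred' inj_eq less_le_trans linorder_less_linear not_less_iff_gr_or_eq zero_less_one)
  have "is_left_peak n p i \<longleftrightarrow> i \<in> {1..<n} \<and> descent p i \<and> (i = 1 \<or> \<not> descent p (i - 1))" for i
    using ne[of i] by (cases "i = 0"; cases "i = 1") (auto simp: is_left_peak_def is_peak_def descent_def numeral_2_eq_2)
  then show ?thesis unfolding lpk_def peak_count_def by presburger
qed

lemma des_eq_card_descent: "des n p = card {i\<in>{1..<n}. descent p i}"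
proof -
  have "is_descent n p i \<longleftrightarrow> i \<in> {1..<n} \<and> descent p i" for i
    by (auto simp: is_descent_def descent_def)
  then show ?thesis unfolding des_def by presburger
qed

subsection \<open>Substitution of power series\<close>

definition peak_subst :: "'a::field_char_0 fps" where
  "peak_subst = 4 * fps_X * inverse ((1 + fps_X) ^ 2)"

lemma one_plus_X_inverse: "(1 + fps_X) ^ 2 * inverse ((1 + fps_X) ^ 2) = (1 :: 'a::field_char_0 fps)"
  by (subst mult.commute, rule inverse_mult_eq_1) (simp add: fps_nth_power_0)

lemma one_plus_X_ne_0: "1 + fps_X \<noteq> (0 :: 'a::field_char_0 fps)"
  by (auto simp: fps_eq_iff intro!: exI[of _ 0])

text \<open>The second equation makes \<open>1 - s\<close> the square of
  \<open>(1 - x) / (1 + x)\<close>, which accounts for the halved exponent of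
  \<open>1 - s\<close>.\<close>

lemma peak_subst_eqs:
  "(1 + fps_X) ^ 2 * peak_subst = (4 * fps_X :: 'a::field_char_0 fps)"
  "(1 + fps_X) ^ 2 * (1 - peak_subst) = ((1 - fps_X) ^ 2 :: 'a fps)"
proof -
  show *: "(1 + fps_X) ^ 2 * peak_subst = (4 * fps_X :: 'a fps)"
    unfolding peak_subst_def using one_plus_X_inverse[where 'a='a] by (metis mult.left_commute mult.right_neutral)
  show "(1 + fps_X) ^ 2 * (1 - peak_subst) = ((1 - fps_X) ^ 2 :: 'a fps)"
    unfolding right_diff_distrib * by (simp add: power2_eq_square algebra_simps)
qed

text \<open>These two coefficients ensure that composition is well behaved and invertible.\<close>

lemma peak_subst_nth: "peak_subst $ 0 = (0 :: 'a::field_char_0)" "peak_subst $ 1 = (4 :: 'a)"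
proof -
  show "peak_subst $ 0 = (0 :: 'a)" by (simp add: peak_subst_def)
  have eq: "peak_subst = fps_const 4 * (fps_X * inverse ((1 + fps_X) ^ 2) :: 'a fps)"
    by (simp add: peak_subst_def mult.assoc numeral_fps_const)
  have "peak_subst $ 1 = 4 * (inverse ((1 + fps_X) ^ 2) :: 'a fps) $ 0"
    unfolding eq fps_mult_left_const_nth fps_X_mult_nth by simp
  then show "peak_subst $ 1 = (4 :: 'a)" by (simp add: fps_nth_power_0)
qed

lemma geometric_series: "(1 - fps_X) * Abs_fps (\<lambda>_. 1) = (1 :: 'a::field_char_0 fps)"
proof (rule fps_ext)
  fix n show "((1 - fps_X) * Abs_fps (\<lambda>_. 1)) $ n = (1 :: 'a fps) $ n"
    by (cases n) (auto simp: left_diff_distrib)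
qed

lemma peak_labelling_series:
  "peak_subst ^ peak_count n d * (1 + fps_X) ^ n =
    (1 - fps_X) ^ Suc n * Abs_fps (\<lambda>m. of_nat (label_count odd d n (2 * m + 1)) :: 'a::field_char_0)"
proof (cases "n \<ge> 1")
  case True
  let ?p = "peak_count n d"
  let ?G = "Abs_fps (\<lambda>m. of_nat (label_count odd d n (2 * m + 1)) :: 'a)"
  have "(1 + fps_X) ^ (2 * ?p) * (peak_subst ^ ?p * (1 + fps_X) ^ n) =
    ((1 + fps_X) ^ 2 * peak_subst) ^ ?p * ((1 + fps_X) ^ n :: 'a fps)"
    by (simp only: power_mult power_mult_distrib mult.assoc)
  also have "\<dots> = (1 + fps_X) ^ (2 * ?p) * ((1 - fps_X) ^ Suc n * ?G)"
    unfolding peak_subst_eqs(1) using peak_labelling_series_aux[OF True, of d, where 'a='a]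
    by (simp only: mult_ac)
  finally show ?thesis using one_plus_X_ne_0[where 'a='a] by simp
next
  case False
  then have "n = 0" by simp
  then show ?thesis using geometric_series[where 'a='a] by (simp add: peak_count_def)
qed

text \<open>Standardization with constant statistics sums the label counts over all permutations to
  \<open>(2 * m + 1) ^ k\<close>.\<close>

lemma P_lpk_series:
  "P_lpk k peak_subst * (1 + fps_X) ^ k =
    (1 - fps_X) ^ Suc k * Abs_fps (\<lambda>m. of_nat (2 * m + 1) ^ k :: 'a::field_char_0)"
proof (cases "k = 0")
  case True
  then show ?thesis using geometric_series[where 'a='a] by (simp add: P_lpk_def)
next
  case False
  have count: "(\<Sum>p\<in>sym_perms k. of_nat (label_count odd (descent p) k M)) = (of_nat M ^ k :: 'a)" for M
    using sum_labellings_eq_sum_words[of k odd M "\<lambda>_. 1" "\<lambda>_. 1 :: 'a"] by (simp add: card_PiE)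
  have "P_lpk k peak_subst * (1 + fps_X) ^ k =
    (\<Sum>p\<in>sym_perms k. peak_subst ^ peak_count k (descent p) * (1 + fps_X) ^ k :: 'a fps)"
    using False unfolding P_lpk_def
    by (auto simp: sum_distrib_right sym_perms_iff lpk_eq_peak_count intro!: sum.cong)
  also have "\<dots> = (1 - fps_X) ^ Suc k * (\<Sum>p\<in>sym_perms k. Abs_fps (\<lambda>m. of_nat (label_count odd (descent p) k (2 * m + 1)) :: 'a))"
    unfolding peak_labelling_series sum_distrib_left ..
  also have "(\<Sum>p\<in>sym_perms k. Abs_fps (\<lambda>m. of_nat (label_count odd (descent p) k (2 * m + 1)) :: 'a)) =
    Abs_fps (\<lambda>m. of_nat (2 * m + 1) ^ k)"
    by (rule fps_ext) (simp only: fps_sum_nth fps_nth_Abs_fps count)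
  finally show ?thesis .
qed

text \<open>After multiplication by \<open>(1 + X)^n\<close> both sides are
  \<open>(1 - X)^(n + 1)\<close> times a series, and the coefficients agree by
  \<open>sum_words_peak_labellings\<close>.\<close>

lemma words_peak_identity_subst:
  "fact n * (\<Sum>w\<in>{1..n} \<rightarrow>\<^sub>E {..<j}. peak_subst ^ peak_count n (descent w)) =
    (\<Sum>p\<in>sym_perms n. (1 - peak_subst) ^ ((n - odd_cycle_count n p) div 2) *
      P_lpk (odd_cycle_count n p) peak_subst * of_nat j ^ card (cycles n p) :: 'a::field_char_0 fps)"
proof -
  let ?X = "1 + fps_X :: 'a fps" and ?Y = "1 - fps_X :: 'a fps"
  \<comment> \<open>Write \<open>n = k + 2 * h\<close> with \<open>k\<close> odd cycles:
    \<open>(1 + X)^(2 * h)\<close> clears the denominator of \<open>(1 - s)^h\<close>, and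
    \<open>(1 + X)^k\<close> that of \<open>P_lpk k\<close>.\<close>
  have summand: "(1 - peak_subst) ^ ((n - odd_cycle_count n p) div 2) *
      P_lpk (odd_cycle_count n p) peak_subst * of_nat j ^ card (cycles n p) * ?X ^ n =
      ?Y ^ Suc n * Abs_fps (\<lambda>m. of_nat (2 * m + 1) ^ odd_cycle_count n p * of_nat j ^ card (cycles n p))"
    if p: "p \<in> sym_perms n" for p
  proof -
    let ?k = "odd_cycle_count n p"
    define h where "h = (n - ?k) div 2"
    have n: "n = ?k + 2 * h"
      using odd_cycle_count_parity(1,2)[of p n] p by (auto simp: sym_perms_iff h_def)
    have X: "?X ^ n = ?X ^ ?k * (?X ^ 2) ^ h" and Y: "?Y ^ Suc n = ?Y ^ Suc ?k * (?Y ^ 2) ^ h"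
      by (subst n, simp add: power_add power_mult)+
    have "(1 - peak_subst) ^ h * P_lpk ?k peak_subst * of_nat j ^ card (cycles n p) * ?X ^ n =
      (?X ^ 2 * (1 - peak_subst)) ^ h * (P_lpk ?k peak_subst * ?X ^ ?k) * of_nat j ^ card (cycles n p)"
      unfolding X power_mult_distrib by (simp only: mult_ac)
    also have "\<dots> = ?Y ^ Suc n * (of_nat j ^ card (cycles n p) * Abs_fps (\<lambda>m. of_nat (2 * m + 1) ^ ?k))"
      unfolding peak_subst_eqs(2) P_lpk_series Y by (simp only: mult_ac)
    also have "of_nat j ^ card (cycles n p) * Abs_fps (\<lambda>m. of_nat (2 * m + 1) ^ ?k) =
      Abs_fps (\<lambda>m. of_nat (2 * m + 1) ^ ?k * of_nat j ^ card (cycles n p) :: 'a)"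
    proof -
      have "of_nat j ^ card (cycles n p) = fps_const (of_nat j ^ card (cycles n p) :: 'a)"
        by (simp add: fps_of_nat flip: fps_const_power)
      then show ?thesis by (intro fps_ext) (simp add: mult.commute)
    qed
    finally show ?thesis unfolding h_def .
  qed
  have "fact n * (\<Sum>w\<in>{1..n} \<rightarrow>\<^sub>E {..<j}. peak_subst ^ peak_count n (descent w)) * ?X ^ n =
    ?Y ^ Suc n * (fact n * (\<Sum>w\<in>{1..n} \<rightarrow>\<^sub>E {..<j}. Abs_fps (\<lambda>m. of_nat (label_count odd (descent w) n (2 * m + 1)))))"
    unfolding mult.assoc sum_distrib_right peak_labelling_series sum_distrib_left[symmetric]
    by (rule mult.left_commute)
  also have "fact n * (\<Sum>w\<in>{1..n} \<rightarrow>\<^sub>E {..<j}. Abs_fps (\<lambda>m. of_nat (label_count odd (descent w) n (2 * m + 1)))) =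
    Abs_fps (\<lambda>m. fact n * of_nat (\<Sum>w\<in>{1..n} \<rightarrow>\<^sub>E {..<j}. label_count odd (descent w) n (2 * m + 1)) :: 'a)"
  proof (rule fps_ext)
    fix m
    have "fact n = fps_const (fact n :: 'a)" by (metis fps_of_nat of_nat_fact)
    then show "(fact n * (\<Sum>w\<in>{1..n} \<rightarrow>\<^sub>E {..<j}. Abs_fps (\<lambda>m. of_nat (label_count odd (descent w) n (2 * m + 1))))) $ m =
      Abs_fps (\<lambda>m. fact n * of_nat (\<Sum>w\<in>{1..n} \<rightarrow>\<^sub>E {..<j}. label_count odd (descent w) n (2 * m + 1)) :: 'a) $ m"
      by (simp add: fps_sum_nth)
  qed
  also have "\<dots> = (\<Sum>p\<in>sym_perms n. Abs_fps (\<lambda>m. of_nat (2 * m + 1) ^ odd_cycle_count n p * of_nat j ^ card (cycles n p)))"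
    unfolding sum_words_peak_labellings by (rule fps_ext) (simp add: fps_sum_nth)
  also have "?Y ^ Suc n * \<dots> = (\<Sum>p\<in>sym_perms n. (1 - peak_subst) ^ ((n - odd_cycle_count n p) div 2) *
      P_lpk (odd_cycle_count n p) peak_subst * of_nat j ^ card (cycles n p)) * ?X ^ n"
    unfolding sum_distrib_left sum_distrib_right by (rule sum.cong[OF refl]) (rule summand[symmetric])
  finally show ?thesis using one_plus_X_ne_0[where 'a='a] by simp
qed

lemma fps_compose_peak_subst_inject:
  assumes "f oo peak_subst = g oo (peak_subst :: 'a::field_char_0 fps)"
  shows "f = g"
proof -
  let ?I = "fps_inv (peak_subst :: 'a fps)"
  have "peak_subst oo ?I = fps_X"
    by (rule fps_inv_right) (use peak_subst_nth[where 'a='a] in auto)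
  then have "h oo peak_subst oo ?I = h" for h :: "'a fps"
    by (subst fps_compose_assoc[symmetric]) (auto simp: peak_subst_nth fps_inv_def)
  then show ?thesis using assms by metis
qed

text \<open>Both sides are polynomials in \<open>s\<close>. They agree at \<open>peak_subst\<close>,
  which has a compositional inverse, so they agree identically.\<close>

lemma words_peak_identity:
  fixes s :: "'a::field_char_0"
  shows "fact n * (\<Sum>w\<in>{1..n} \<rightarrow>\<^sub>E {..<j}. s ^ peak_count n (descent w)) =
    (\<Sum>p\<in>sym_perms n. (1 - s) ^ ((n - odd_cycle_count n p) div 2) *
      P_lpk (odd_cycle_count n p) s * of_nat j ^ card (cycles n p))"
proof -
  \<comment> \<open>\<open>L\<close> and \<open>R\<close> are the two sides with the indeterminate
    \<open>[:0, 1:]\<close> in place of \<open>s\<close>.\<close>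
  define L :: "'a poly" where "L = of_nat (fact n) * (\<Sum>w\<in>{1..n} \<rightarrow>\<^sub>E {..<j}. [:0, 1:] ^ peak_count n (descent w))"
  define R :: "'a poly" where "R = (\<Sum>p\<in>sym_perms n. (1 - [:0, 1:]) ^ ((n - odd_cycle_count n p) div 2) *
      P_lpk (odd_cycle_count n p) [:0, 1:] * of_nat j ^ card (cycles n p))"
  let ?S = "peak_subst :: 'a fps"
  have S0: "?S $ 0 = 0" by (rule peak_subst_nth)
  have of_nat_poly: "fps_of_poly (of_nat k) = (of_nat k :: 'a fps)" for k
    by (simp add: of_nat_poly fps_of_poly_const fps_of_nat)
  have of_nat_oo: "of_nat k oo ?S = of_nat k" for k
    by (metis fps_const_compose fps_of_nat)
  have P: "fps_of_poly (P_lpk k [:0, 1:]) oo ?S = P_lpk k ?S" for k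
    by (simp add: P_lpk_def fps_of_poly_sum fps_of_poly_power fps_compose_sum_distrib fps_compose_power[OF S0, symmetric] S0)
  have "fps_of_poly L oo ?S = of_nat (fact n) * (\<Sum>w\<in>{1..n} \<rightarrow>\<^sub>E {..<j}. ?S ^ peak_count n (descent w))"
    unfolding L_def fps_of_poly_mult fps_of_poly_sum fps_of_poly_power of_nat_poly fps_of_poly_fps_X
      fps_compose_mult_distrib[OF S0] fps_compose_sum_distrib fps_compose_power[OF S0, symmetric] of_nat_oo
    by (simp add: S0)
  also have "\<dots> = (\<Sum>p\<in>sym_perms n. (1 - ?S) ^ ((n - odd_cycle_count n p) div 2) *
      P_lpk (odd_cycle_count n p) ?S * of_nat j ^ card (cycles n p))"
    using words_peak_identity_subst[of n j, where 'a='a] by simp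
  also have "\<dots> = fps_of_poly R oo ?S"
    unfolding R_def fps_of_poly_mult fps_of_poly_sum fps_of_poly_power of_nat_poly fps_of_poly_fps_X fps_of_poly_diff
      fps_compose_mult_distrib[OF S0] fps_compose_sum_distrib fps_compose_power[OF S0, symmetric] of_nat_oo P fps_compose_sub_distrib
    by (simp add: S0)
  finally have "L = R"
    using fps_compose_peak_subst_inject fps_of_poly_eq_iff by blast
  then have "poly L s = poly R s" by simp
  moreover have "poly (P_lpk k [:0, 1:]) s = P_lpk k s" for k
    by (simp add: P_lpk_def poly_sum poly_power)
  ultimately show ?thesis
    by (simp add: L_def R_def poly_sum poly_power del: of_nat_fact) simp
qed

section \<open>Series in \<open>t\<close> and the final comparison\<close>

lemma descent_word_series:
  assumes "n \<ge> 1"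
  shows "fps_X ^ Suc (des n p) = (1 - fps_X) ^ Suc n *
    Abs_fps (\<lambda>j. of_nat (label_count (\<lambda>_. False) (descent p) n j) :: 'a::field_char_0)"
  using descent_labelling_series[OF assms, of "descent p", where 'a='a] by (simp add: des_eq_card_descent)

text \<open>The classical expansion of Eulerian polynomials: by standardization the label counts add
  up to \<open>j ^ m\<close>. For \<open>m = 0\<close> it is the geometric series, with
  \<open>0 ^ 0 = 1\<close>.\<close>

lemma A_poly_series:
  "A_poly m fps_X = (1 - fps_X) ^ Suc m * Abs_fps (\<lambda>j. of_nat j ^ m :: 'a::field_char_0)"
proof (cases "m = 0")
  case True
  then show ?thesis using geometric_series[where 'a='a] by (simp add: A_poly_def)
next
  case False
  have count: "(\<Sum>p\<in>sym_perms m. of_nat (label_count (\<lambda>_. False) (descent p) m M)) = (of_nat M ^ m :: 'a)" for M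
    using sum_labellings_eq_sum_words[of m "\<lambda>_. False" M "\<lambda>_. 1" "\<lambda>_. 1 :: 'a"] by (simp add: card_PiE)
  have "A_poly m fps_X = (\<Sum>p\<in>sym_perms m. (1 - fps_X) ^ Suc m *
    Abs_fps (\<lambda>j. of_nat (label_count (\<lambda>_. False) (descent p) m j) :: 'a))"
    using False descent_word_series[of m, where 'a='a] by (simp add: A_poly_def)
  also have "\<dots> = (1 - fps_X) ^ Suc m * Abs_fps (\<lambda>j. of_nat j ^ m)"
    unfolding sum_distrib_left[symmetric]
    by (rule arg_cong[where f = "(*) _"], rule fps_ext) (simp add: fps_sum_nth count)
  finally show ?thesis .
qed

text \<open>The permutation \<open>inv \<rho>\<close> is the standardization of the word
  \<open>g \<circ> inv \<rho>\<close> with ties broken from left to right, so both have the same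
  descents.\<close>

lemma lpk_inv_eq_word_peaks:
  assumes \<rho>: "\<rho> permutes {1..n}" and g: "g \<in> labellings (\<lambda>_. False) (descent \<rho>) n M"
  shows "lpk n (inv \<rho>) = peak_count n (descent (g \<circ> inv \<rho>))"
proof -
  have i\<rho>: "inv \<rho> permutes {1..n}" using permutes_inv[OF \<rho>] .
  have im: "inv \<rho> v \<in> {1..n}" if "v \<in> {1..n}" for v using permutes_in_image[OF i\<rho>, of v] that by simp
  have eq: "descent (inv \<rho>) i \<longleftrightarrow> descent (g \<circ> inv \<rho>) i" if "i \<in> {1..<n}" for i
  proof -
    have ii: "i \<in> {1..n}" "Suc i \<in> {1..n}" using that by auto
    have "inv \<rho> (Suc i) < inv \<rho> i \<longleftrightarrow>
      label_key (\<lambda>_. False) n (g (inv \<rho> (Suc i))) (Suc i) < label_key (\<lambda>_. False) n (g (inv \<rho> i)) i"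
      using g[unfolded labellings_descent_iff[OF \<rho>]] im[OF ii(1)] im[OF ii(2)]
      by (simp add: permutes_inverses(1)[OF \<rho>])
    then show ?thesis using label_key_less_iff[OF ii(2,1)] by (simp add: descent_def)
  qed
  have "{i\<in>{1..<n}. descent (inv \<rho>) i \<and> (i = 1 \<or> \<not> descent (inv \<rho>) (i - 1))} =
    {i\<in>{1..<n}. descent (g \<circ> inv \<rho>) i \<and> (i = 1 \<or> \<not> descent (g \<circ> inv \<rho>) (i - 1))}"
  proof (rule Collect_cong)
    fix i
    show "(i \<in> {1..<n} \<and> descent (inv \<rho>) i \<and> (i = 1 \<or> \<not> descent (inv \<rho>) (i - 1))) \<longleftrightarrow>
      (i \<in> {1..<n} \<and> descent (g \<circ> inv \<rho>) i \<and> (i = 1 \<or> \<not> descent (g \<circ> inv \<rho>) (i - 1)))"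
    proof (cases "i \<in> {1..<n} \<and> i \<noteq> 1")
      case True
      then have "i - 1 \<in> {1..<n}" by auto
      then show ?thesis using eq[of i] eq[of "i - 1"] True by simp
    qed (use eq[of i] in auto)
  qed
  then show ?thesis unfolding lpk_eq_peak_count[OF i\<rho>] peak_count_def by simp
qed

text \<open>Permutations are grouped by their two cycle counts, both at most \<open>n\<close>, so
  the ranges of summation miss none.\<close>

lemma sum_f_cyc:
  fixes g :: "nat \<Rightarrow> nat \<Rightarrow> 'a::comm_semiring_1"
  shows "(\<Sum>k=0..n. \<Sum>m=0..n. of_nat (f_cyc n k m) * g k m) =
    (\<Sum>p\<in>sym_perms n. g (odd_cycle_count n p) (card (cycles n p)))"
proof -
  have fin: "finite (sym_perms n)" by (simp add: sym_perms_def finite_permutations)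
  have f: "of_nat (f_cyc n k m) * g k m =
    (\<Sum>p\<in>sym_perms n. if odd_cycle_count n p = k then if card (cycles n p) = m then g k m else 0 else 0)" for k m
  proof -
    have "of_nat (f_cyc n k m) * g k m = (\<Sum>p | p \<in> sym_perms n \<and> odd_cycle_count n p = k \<and> card (cycles n p) = m. g k m)"
      by (simp add: f_cyc_def odd_cycle_count_def)
    also have "\<dots> = (\<Sum>p\<in>sym_perms n. if odd_cycle_count n p = k \<and> card (cycles n p) = m then g k m else 0)"
      by (rule sum.inter_filter[OF fin])
    also have "\<dots> = (\<Sum>p\<in>sym_perms n. if odd_cycle_count n p = k then if card (cycles n p) = m then g k m else 0 else 0)"
      by (intro sum.cong) auto
    finally show ?thesis .
  qed
  have "(\<Sum>k=0..n. \<Sum>m=0..n. of_nat (f_cyc n k m) * g k m) =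
    (\<Sum>p\<in>sym_perms n. \<Sum>k=0..n. \<Sum>m=0..n. if odd_cycle_count n p = k then if card (cycles n p) = m then g k m else 0 else 0)"
    unfolding f by (subst sum.swap, subst sum.swap[of _ "sym_perms n"], simp add: sum.swap[of _ "sym_perms n"])
  also have "\<dots> = (\<Sum>p\<in>sym_perms n. g (odd_cycle_count n p) (card (cycles n p)))"
  proof (rule sum.cong[OF refl])
    fix p assume "p \<in> sym_perms n"
    then have le: "odd_cycle_count n p \<le> n" "card (cycles n p) \<le> n"
      using odd_cycle_count_parity(1,3) by (auto simp: sym_perms_iff)
    have "(\<Sum>k=0..n. \<Sum>m=0..n. if odd_cycle_count n p = k then if card (cycles n p) = m then g k m else 0 else 0) =
      (\<Sum>k=0..n. if odd_cycle_count n p = k then \<Sum>m=0..n. if card (cycles n p) = m then g k m else 0 else 0)"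
      by (intro sum.cong) auto
    also have "\<dots> = g (odd_cycle_count n p) (card (cycles n p))"
      using le by (simp add: sum.delta)
    finally show "(\<Sum>k=0..n. \<Sum>m=0..n. if odd_cycle_count n p = k then if card (cycles n p) = m then g k m else 0 else 0) =
      g (odd_cycle_count n p) (card (cycles n p))" .
  qed
  finally show ?thesis .
qed

lemma P_lpk_ides_series:
  fixes s :: "'a::field_char_0"
  assumes "n \<ge> 1"
  shows "P_lpk_ides n (fps_const s) fps_X =
    (1 - fps_X) ^ Suc n * Abs_fps (\<lambda>j. \<Sum>w\<in>{1..n} \<rightarrow>\<^sub>E {..<j}. s ^ peak_count n (descent w))"
proof -
  \<comment> \<open>Summing over inverses turns \<open>ides\<close> into \<open>des\<close> and
    moves the inverse to \<open>lpk\<close>, where standardization applies.\<close>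
  have "P_lpk_ides n (fps_const s) fps_X =
    (\<Sum>\<rho>\<in>sym_perms n. fps_const (s ^ lpk n (inv \<rho>)) * fps_X ^ Suc (des n \<rho>))"
    unfolding P_lpk_ides_def ides_def
    by (rule sum.reindex_bij_witness[where i = inv and j = inv])
       (auto simp: sym_perms_iff permutes_inv permutes_inv_inv)
  also have "\<dots> = (\<Sum>\<rho>\<in>sym_perms n. (1 - fps_X) ^ Suc n *
      (fps_const (s ^ lpk n (inv \<rho>)) * Abs_fps (\<lambda>j. of_nat (label_count (\<lambda>_. False) (descent \<rho>) n j))))"
    unfolding descent_word_series[OF assms] by (simp only: mult.left_commute)
  also have "\<dots> = (1 - fps_X) ^ Suc n * Abs_fps (\<lambda>j. \<Sum>\<rho>\<in>sym_perms n.
      s ^ lpk n (inv \<rho>) * of_nat (label_count (\<lambda>_. False) (descent \<rho>) n j))"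
    unfolding sum_distrib_left[symmetric]
    by (rule arg_cong[where f = "(*) _"], rule fps_ext) (simp add: fps_sum_nth)
  also have "(\<lambda>j. \<Sum>\<rho>\<in>sym_perms n. s ^ lpk n (inv \<rho>) * of_nat (label_count (\<lambda>_. False) (descent \<rho>) n j)) =
    (\<lambda>j. \<Sum>w\<in>{1..n} \<rightarrow>\<^sub>E {..<j}. s ^ peak_count n (descent w))"
    by (rule ext, rule sum_labellings_eq_sum_words) (simp add: lpk_inv_eq_word_peaks)
  finally show ?thesis .
qed

theorem theorem4p10:
  fixes n :: nat and s t :: "'a::field_char_0"
  assumes "n \<ge> 1"
  shows "P_lpk_ides n s t =
    1 / fact n * (\<Sum>k=0..n. \<Sum>m=0..n.
      of_nat (f_cyc n k m) * (1 - s) ^ ((n - k) div 2) * (1 - t) ^ (n - m) * P_lpk k s * A_poly m t)"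
proof -
  define c where "c p = (1 - s) ^ ((n - odd_cycle_count n p) div 2) * P_lpk (odd_cycle_count n p) s" for p
  \<comment> \<open>With \<open>s\<close> fixed, both sides become polynomials in \<open>t\<close>,
    compared through their power series and evaluated at \<open>t\<close> afterwards.\<close>
  define L :: "'a poly" where "L = [:fact n:] * P_lpk_ides n [:s:] [:0, 1:]"
  define R :: "'a poly" where "R = (\<Sum>p\<in>sym_perms n. [:c p:] * ((1 - [:0, 1:]) ^ (n - card (cycles n p)) * A_poly (card (cycles n p)) [:0, 1:]))"
  have "fps_of_poly L = fps_const (fact n) * P_lpk_ides n (fps_const s) fps_X"
    unfolding L_def P_lpk_ides_def fps_of_poly_mult fps_of_poly_sum fps_of_poly_power fps_of_poly_const fps_of_poly_fps_X ..
  also have "\<dots> = (1 - fps_X) ^ Suc n * (fps_const (fact n) * Abs_fps (\<lambda>j. \<Sum>w\<in>{1..n} \<rightarrow>\<^sub>E {..<j}. s ^ peak_count n (descent w)))"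
    unfolding P_lpk_ides_series[OF assms] by (rule mult.left_commute)
  also have "fps_const (fact n) * Abs_fps (\<lambda>j. \<Sum>w\<in>{1..n} \<rightarrow>\<^sub>E {..<j}. s ^ peak_count n (descent w)) =
    Abs_fps (\<lambda>j. \<Sum>p\<in>sym_perms n. c p * of_nat j ^ card (cycles n p))"
    by (rule fps_ext) (simp only: fps_mult_left_const_nth fps_nth_Abs_fps words_peak_identity c_def)
  also have "\<dots> = (\<Sum>p\<in>sym_perms n. fps_const (c p) * Abs_fps (\<lambda>j. of_nat j ^ card (cycles n p)))"
    by (rule fps_ext) (simp add: fps_sum_nth)
  also have "(1 - fps_X) ^ Suc n * \<dots> =
    (\<Sum>p\<in>sym_perms n. fps_const (c p) * ((1 - fps_X) ^ (n - card (cycles n p)) * A_poly (card (cycles n p)) fps_X))"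
    unfolding sum_distrib_left
  proof (rule sum.cong[OF refl])
    fix p assume "p \<in> sym_perms n"
    \<comment> \<open>Since there are at most \<open>n\<close> cycles,
      \<open>(1 - X)^(n + 1)\<close> supplies the denominator of the Eulerian series and leaves
      \<open>(1 - X)^(n - m)\<close>, where \<open>m\<close> is the number of cycles.\<close>
    then have "Suc n = (n - card (cycles n p)) + Suc (card (cycles n p))"
      using odd_cycle_count_parity(3)[of p n] by (simp add: sym_perms_iff)
    then have "(1 - fps_X :: 'a fps) ^ Suc n = (1 - fps_X) ^ (n - card (cycles n p)) * (1 - fps_X) ^ Suc (card (cycles n p))"
      by (metis power_add)
    then show "(1 - fps_X) ^ Suc n * (fps_const (c p) * Abs_fps (\<lambda>j. of_nat j ^ card (cycles n p))) =
      fps_const (c p) * ((1 - fps_X) ^ (n - card (cycles n p)) * A_poly (card (cycles n p)) fps_X)"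
      unfolding A_poly_series by (simp only: mult_ac)
  qed
  also have "\<dots> = fps_of_poly R"
  proof -
    have "fps_of_poly (A_poly m [:0, 1:]) = (A_poly m fps_X :: 'a fps)" for m
      unfolding A_poly_def
      by (cases "m = 0")
         (simp, simp only: if_False fps_of_poly_sum fps_of_poly_power fps_of_poly_fps_X)
    then show ?thesis
      unfolding R_def fps_of_poly_mult fps_of_poly_sum fps_of_poly_power fps_of_poly_const fps_of_poly_fps_X fps_of_poly_diff
      by simp
  qed
  finally have "L = R" by (simp only: fps_of_poly_eq_iff)
  then have "poly L t = poly R t" by simp
  moreover have "poly (A_poly m [:0, 1:]) t = A_poly m t" for m
    by (simp add: A_poly_def poly_sum poly_power)
  ultimately have "fact n * P_lpk_ides n s t =
    (\<Sum>p\<in>sym_perms n. c p * ((1 - t) ^ (n - card (cycles n p)) * A_poly (card (cycles n p)) t))"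
    by (simp add: L_def R_def P_lpk_ides_def poly_sum poly_power mult.left_commute)
  also have "\<dots> = (\<Sum>k=0..n. \<Sum>m=0..n. of_nat (f_cyc n k m) *
      ((1 - s) ^ ((n - k) div 2) * P_lpk k s * ((1 - t) ^ (n - m) * A_poly m t)))"
    unfolding sum_f_cyc c_def ..
  also have "\<dots> = (\<Sum>k=0..n. \<Sum>m=0..n.
      of_nat (f_cyc n k m) * (1 - s) ^ ((n - k) div 2) * (1 - t) ^ (n - m) * P_lpk k s * A_poly m t)"
    by (simp only: mult_ac)
  finally show ?thesis by (simp add: field_simps)
qed

end
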